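(* Let $G$ be a complete geometric graph and let $B$ be a subgraph of $G$. If $B$ is a blocker for $\mathcal{T}_{\leq 4}(G)$, then $B$ is either a star of $G$ or a comb of $G$.
   Context: A geometric graph is a graph whose vertices are points in the plane in general position (no three collinear) and whose edges are straight segments between pairs of vertices; $G$ is complete if all pairs of vertices are joined. A geometric graph is simple if no two of its edges cross. $\mathcal{T}_{\leq k}(G)$ denotes the family of all simple (non-crossing) spanning trees of $G$ of (graph) diameter at most $k$. For a family $\mathcal{F}$ of subgraphs of $G$, a subgraph $B$ blocks $\mathcal{F}$ if it shares at least one edge with every member of $\mathcal{F}$; a blocker of $\mathcal{F}$ is a subgraph that blocks $\mathcal{F}$ and has the smallest possible number of edges among all subgraphs blocking $\mathcal{F}$. A star of $G$ is the set of all edges of $G$ emanating from a single vertex. A comb of $G$ is a simple spanning subgraph $B$ of $G$ such that: (1) the intersection of $B$ with the boundary of $\mathrm{conv}(V(G))$ is a simple path $P$; (2) each vertex in $V(G)\setminus P$ is connected by a unique edge of $B$ to an interior (non-endpoint) vertex of $P$; (3) for each edge $e$ of $B$, the line spanned by $e$ does not cross any edge of $B$. *)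

theory Defs
  imports "HOL-Analysis.Analysis"
begin

type_synonym point = "real^2"
type_synonym edge = "point set"

definition general_position :: "point set \<Rightarrow> bool" where
  "general_position V \<longleftrightarrow>
     (\<forall>a\<in>V. \<forall>b\<in>V. \<forall>c\<in>V. a \<noteq> b \<and> a \<noteq> c \<and> b \<noteq> c \<longrightarrow> \<not> collinear {a, b, c})"

definition complete_edges :: "point set \<Rightarrow> edge set" where
  "complete_edges V = {{a, b} | a b. a \<in> V \<and> b \<in> V \<and> a \<noteq> b}"

definition edges_cross :: "edge \<Rightarrow> edge \<Rightarrow> bool" where
  "edges_cross e f \<longleftrightarrow> e \<noteq> f \<and> \<not> (convex hull e \<inter> convex hull f \<subseteq> e \<inter> f)"

definition noncrossing :: "edge set \<Rightarrow> bool" where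
  "noncrossing T \<longleftrightarrow> (\<forall>e\<in>T. \<forall>f\<in>T. \<not> edges_cross e f)"

definition is_walk :: "edge set \<Rightarrow> point list \<Rightarrow> bool" where
  "is_walk T xs \<longleftrightarrow> xs \<noteq> [] \<and> (\<forall>i. Suc i < length xs \<longrightarrow> {xs ! i, xs ! Suc i} \<in> T)"

definition has_cycle :: "edge set \<Rightarrow> bool" where
  "has_cycle T \<longleftrightarrow> (\<exists>xs. length xs \<ge> 3 \<and> distinct xs \<and> is_walk T xs \<and> {last xs, hd xs} \<in> T)"

definition connected_graph :: "point set \<Rightarrow> edge set \<Rightarrow> bool" where
  "connected_graph V T \<longleftrightarrow>
     (\<forall>u\<in>V. \<forall>v\<in>V. \<exists>xs. is_walk T xs \<and> hd xs = u \<and> last xs = v \<and> set xs \<subseteq> V)"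

definition spanning_tree :: "point set \<Rightarrow> edge set \<Rightarrow> bool" where
  "spanning_tree V T \<longleftrightarrow> T \<subseteq> complete_edges V \<and> connected_graph V T \<and> \<not> has_cycle T"

definition diameter_le :: "point set \<Rightarrow> edge set \<Rightarrow> nat \<Rightarrow> bool" where
  "diameter_le V T k \<longleftrightarrow>
     (\<forall>u\<in>V. \<forall>v\<in>V. \<exists>xs. is_walk T xs \<and> hd xs = u \<and> last xs = v \<and> length xs \<le> Suc k)"

definition trees_le :: "point set \<Rightarrow> nat \<Rightarrow> edge set set" where
  "trees_le V k = {T. spanning_tree V T \<and> noncrossing T \<and> diameter_le V T k}"

definition blocks :: "edge set \<Rightarrow> edge set set \<Rightarrow> bool" where
  "blocks B F \<longleftrightarrow> (\<forall>T\<in>F. B \<inter> T \<noteq> {})"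

definition is_blocker :: "point set \<Rightarrow> edge set set \<Rightarrow> edge set \<Rightarrow> bool" where
  "is_blocker V F B \<longleftrightarrow> B \<subseteq> complete_edges V \<and> blocks B F \<and>
     (\<forall>B'. B' \<subseteq> complete_edges V \<and> blocks B' F \<longrightarrow> card B \<le> card B')"

definition is_star :: "point set \<Rightarrow> edge set \<Rightarrow> bool" where
  "is_star V B \<longleftrightarrow> (\<exists>v\<in>V. B = {{v, w} | w. w \<in> V \<and> w \<noteq> v})"

definition path_edges :: "point list \<Rightarrow> edge set" where
  "path_edges xs = {{xs ! i, xs ! Suc i} | i. Suc i < length xs}"

definition path_interior :: "point list \<Rightarrow> point set" where
  "path_interior xs = {xs ! i | i. 0 < i \<and> Suc i < length xs}"

definition line_crosses :: "edge \<Rightarrow> edge \<Rightarrow> bool" where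
  "line_crosses e f \<longleftrightarrow> affine hull e \<inter> f = {} \<and> affine hull e \<inter> convex hull f \<noteq> {}"

definition is_comb :: "point set \<Rightarrow> edge set \<Rightarrow> bool" where
  "is_comb V B \<longleftrightarrow> B \<subseteq> complete_edges V \<and> noncrossing B \<and>
     (\<exists>xs. xs \<noteq> [] \<and> distinct xs \<and> set xs \<subseteq> V \<and>
        {e \<in> B. convex hull e \<subseteq> frontier (convex hull V)} = path_edges xs \<and>
        (\<forall>v\<in>V - set xs. \<exists>!e. e \<in> B \<and> (\<exists>u\<in>path_interior xs. e = {v, u}))) \<and>
     (\<forall>e\<in>B. \<forall>f\<in>B. \<not> line_crosses e f)"

end

theory Submission
  imports Defs
begin

text \<open>
  Stars block every spanning tree and are themselves among the trees to be blocked, so a blocker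
  \<open>B\<close> has at most \<open>card V - 1\<close> edges and no isolated vertex; hence it has a leaf \<open>c\<close>, with neighbour
  \<open>x\<close> say. For each other vertex \<open>z\<close> there is a non-crossing tree in which every vertex is within
  distance two of \<open>c\<close> and which forces an edge of \<open>B\<close> from \<open>z\<close> to \<open>x\<close> or to some \<open>w\<close> for which
  \<open>c, x, w, z\<close> is a convex quadrilateral. These edges are distinct, so they make up all of \<open>B\<close>: it is a
  tree, and every leaf edge lies on one side of the line of any disjoint edge. A second family of
  trees shows that paths of \<open>B\<close> starting at a leaf never turn the wrong way. Together these facts
  put all vertices on one side of each edge joining two non-leaves, so such edges lie on the convex
  hull. If \<open>B\<close> is not a star, each non-leaf meets exactly two hull edges of \<open>B\<close>, and a longest path
  of hull edges is the spine of a comb.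
\<close>

section \<open>Orientation and crossing\<close>

text \<open>Twice the signed area of the triangle, positive for counterclockwise triples. Later
  statements multiply it by a factor \<open>s\<close>, so that both orientations are handled at
  once.\<close>

definition orient :: "point \<Rightarrow> point \<Rightarrow> point \<Rightarrow> real" where
  "orient a b c = (b$1 - a$1) * (c$2 - a$2) - (b$2 - a$2) * (c$1 - a$1)"

lemma orient_rot: "orient b c a = orient a b c"
  by (simp add: orient_def algebra_simps)

lemma orient_swap: "orient a c b = - orient a b c"
  by (simp add: orient_def algebra_simps)

lemma orient_same [simp]: "orient a a b = 0" "orient a b a = 0" "orient a b b = 0"
  by (simp_all add: orient_def algebra_simps)

lemma orient_affine:
  assumes "u + v = 1"
  shows "orient p q (u *\<^sub>R a + v *\<^sub>R b) = u * orient p q a + v * orient p q b"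
proof -
  have v: "v = 1 - u" using assms by simp
  show ?thesis unfolding v by (simp add: orient_def algebra_simps)
qed

text \<open>The three-term Grassmann-Pluecker relation for the vectors from \<open>c\<close> to the
  other four points.\<close>

lemma orient_pluecker:
  "orient c x w * orient c v z = orient c x z * orient c v w + orient c x v * orient c w z"
  by (simp add: orient_def algebra_simps)

text \<open>The Pluecker relation writes a positive multiple of the wanted value as a sum of
  positive products. This makes the angular order about \<open>c\<close> transitive on an open
  half-plane bounded by the line \<open>cx\<close>.\<close>

lemma orient_trans:
  assumes "s * orient c x v > 0" "s * orient c x w > 0" "s * orient c x z > 0"
    and "s * orient c v w > 0" "s * orient c w z > 0"
  shows "s * orient c v z > 0"
proof -
  have "(s * orient c x w) * (s * orient c v z)
      = (s * orient c x z) * (s * orient c v w) + (s * orient c x v) * (s * orient c w z)"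
    using orient_pluecker[of c x w v z] by algebra
  also have "\<dots> > 0" by (rule add_pos_pos[OF mult_pos_pos[OF assms(3,4)] mult_pos_pos[OF assms(1,5)]])
  finally show ?thesis using assms(2) by (simp add: zero_less_mult_iff)
qed

lemma orient_zero_line:
  assumes "a \<noteq> b" "orient a b c = 0"
  shows "\<exists>t. c = (1 - t) *\<^sub>R a + t *\<^sub>R b"
proof (cases "b$1 = a$1")
  case True
  then have "b$2 \<noteq> a$2" using assms(1) by (metis (full_types) exhaust_2 vec_eq_iff)
  moreover from this have "c$1 = a$1" using assms(2) True by (simp add: orient_def)
  moreover define t where "t = (c$2 - a$2) / (b$2 - a$2)"
  ultimately have "c$2 - a$2 = t * (b$2 - a$2)" "c$1 = a$1" by simp_all
  then show ?thesis using True
    by (intro exI[of _ t]) (simp add: vec_eq_iff forall_2 algebra_simps)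
next
  case False
  define t where "t = (c$1 - a$1) / (b$1 - a$1)"
  have "c$1 - a$1 = t * (b$1 - a$1)" using False t_def by simp
  moreover have "(b$1 - a$1) * (c$2 - a$2) = (b$2 - a$2) * (c$1 - a$1)"
    using assms(2) by (simp add: orient_def)
  then have "(b$1 - a$1) * (c$2 - a$2) = (b$1 - a$1) * (t * (b$2 - a$2))"
    unfolding calculation by (simp add: mult_ac)
  then have "c$2 - a$2 = t * (b$2 - a$2)" using False by simp
  ultimately show ?thesis
    by (intro exI[of _ t]) (simp add: vec_eq_iff forall_2 algebra_simps)
qed

lemma general_position_orient:
  assumes "general_position V" "a \<in> V" "b \<in> V" "c \<in> V" "a \<noteq> b" "a \<noteq> c" "b \<noteq> c"
  shows "orient a b c \<noteq> 0"
proof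
  assume "orient a b c = 0"
  then obtain t where "c = (1 - t) *\<^sub>R a + t *\<^sub>R b" using orient_zero_line assms by blast
  then have "c = (1 - t) *\<^sub>R a + (1 - (1 - t)) *\<^sub>R b" by simp
  then have "collinear {a, c, b}" unfolding collinear_3_expand by blast
  then have "collinear {a, b, c}" by (simp add: insert_commute)
  then show False using assms unfolding general_position_def by blast
qed

text \<open>A convex combination of nonnegative values vanishes only if every term does, so a
  segment on one side of a line and not inside it can touch the line only at an endpoint.\<close>

lemma segment_orient_zero:
  assumes "P \<in> convex hull {a, b}" "orient p q P = 0"
    and "orient p q a \<ge> 0" "orient p q b \<ge> 0" "orient p q a > 0 \<or> orient p q b > 0"
  shows "(P = a \<and> orient p q a = 0) \<or> (P = b \<and> orient p q b = 0)"
proof -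
  obtain u v where uv: "0 \<le> u" "0 \<le> v" "u + v = 1" "P = u *\<^sub>R a + v *\<^sub>R b"
    using assms(1) unfolding convex_hull_2 by auto
  have eq: "u * orient p q a + v * orient p q b = 0"
    using assms(2) orient_affine[OF uv(3)] uv(4) by simp
  have "u * orient p q a = 0" "v * orient p q b = 0"
    using eq uv assms(3,4) by (smt (verit) mult_nonneg_nonneg)+
  then show ?thesis using uv assms(5) by auto
qed

lemma orient_hull_ge:
  assumes "P \<in> convex hull {a, b}" "s * orient p q a \<ge> 0" "s * orient p q b \<ge> 0"
  shows "s * orient p q P \<ge> 0"
proof -
  obtain u v where uv: "0 \<le> u" "0 \<le> v" "u + v = 1" "P = u *\<^sub>R a + v *\<^sub>R b"
    using assms(1) unfolding convex_hull_2 by auto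
  have "s * orient p q P = u * (s * orient p q a) + v * (s * orient p q b)"
    using orient_affine[OF uv(3), of p q a b] uv(4) by (simp add: algebra_simps)
  then show ?thesis using uv assms by simp
qed

lemma orient_hull_gt:
  assumes "P \<in> convex hull {a, b}" "s * orient p q a > 0" "s * orient p q b > 0"
  shows "s * orient p q P > 0"
proof -
  obtain u v where uv: "0 \<le> u" "0 \<le> v" "u + v = 1" "P = u *\<^sub>R a + v *\<^sub>R b"
    using assms(1) unfolding convex_hull_2 by auto
  have "s * orient p q P = u * (s * orient p q a) + v * (s * orient p q b)"
    using orient_affine[OF uv(3), of p q a b] uv(4) by (simp add: algebra_simps)
  then show ?thesis using uv assms
    by (smt (verit) mult_nonneg_nonneg mult_pos_pos)
qed

lemma edges_cross_sym: "edges_cross e f \<Longrightarrow> edges_cross f e"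
  unfolding edges_cross_def by blast

text \<open>One edge lies in a closed half-plane of the line \<open>pq\<close>, the other in the
  complementary open one, so their hulls are disjoint.\<close>

lemma separated_strict:
  assumes "s * orient p q a \<le> 0" "s * orient p q b \<le> 0" "s * orient p q c > 0" "s * orient p q d > 0"
  shows "\<not> edges_cross {a, b} {c, d}"
proof -
  have "convex hull {a, b} \<inter> convex hull {c, d} = {}"
    using orient_hull_ge[of _ a b "-s" p q] orient_hull_gt[of _ c d s p q] assms by fastforce
  then show ?thesis unfolding edges_cross_def by simp
qed

text \<open>Each edge may touch the line \<open>pq\<close>, but only at an endpoint. A common point
  lies on that line, so it is an endpoint of both edges, which \<open>edges_cross\<close>
  permits.\<close>

lemma separated_weak:
  assumes "s * orient p q a \<le> 0" "s * orient p q b \<le> 0" "s * orient p q a < 0 \<or> s * orient p q b < 0"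
    and "s * orient p q c \<ge> 0" "s * orient p q d \<ge> 0" "s * orient p q c > 0 \<or> s * orient p q d > 0"
  shows "\<not> edges_cross {a, b} {c, d}"
proof -
  have key: "P \<in> {a, b}" if P: "P \<in> convex hull {a, b}" "s * orient p q P = 0"
      and h: "s * orient p q a \<le> 0" "s * orient p q b \<le> 0" "s * orient p q a < 0 \<or> s * orient p q b < 0"
    for s a b P
  proof -
    have s: "s \<noteq> 0" using h by auto
    then have z: "orient p q P = 0" using P by simp
    show ?thesis
    proof (cases "s > 0")
      case True
      \<comment> \<open>For positive \<open>s\<close> the values along \<open>pq\<close> are
        nonpositive, so the line is reversed to fit \<open>segment_orient_zero\<close>.\<close>
      then have "orient q p a \<ge> 0" "orient q p b \<ge> 0" "orient q p a > 0 \<or> orient q p b > 0" "orient q p P = 0"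
        using h z orient_swap[of _ q p] orient_rot[of q p] orient_rot[of p q]
        by (auto simp: mult_le_0_iff mult_less_0_iff)
      then show ?thesis using segment_orient_zero[OF P(1)] by blast
    next
      case False
      then have "orient p q a \<ge> 0" "orient p q b \<ge> 0" "orient p q a > 0 \<or> orient p q b > 0"
        using h s by (auto simp: mult_le_0_iff mult_less_0_iff)
      then show ?thesis using segment_orient_zero[OF P(1) z] by blast
    qed
  qed
  have "P \<in> {a, b} \<inter> {c, d}" if "P \<in> convex hull {a, b}" "P \<in> convex hull {c, d}" for P
  proof -
    have z: "s * orient p q P = 0"
      using orient_hull_ge[OF that(1), of "-s" p q] orient_hull_ge[OF that(2), of s p q] assms by simp
    then show ?thesis
      using key[of P a b s] key[of P c d "-s"] that assms by simp
  qed
  then show ?thesis unfolding edges_cross_def by blast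
qed

text \<open>On the first segment \<open>orient a b\<close> vanishes; on the second it is
  \<open>orient a b c\<close> times the weight of \<open>c\<close>. That weight is therefore zero
  and only \<open>a\<close> is shared.\<close>

lemma shared_not_cross:
  assumes "b = c \<or> orient a b c \<noteq> 0"
  shows "\<not> edges_cross {a, b} {a, c}"
proof (cases "b = c")
  case True then show ?thesis by (simp add: edges_cross_def)
next
  case False
  then have o: "orient a b c \<noteq> 0" using assms by simp
  have "P = a" if P: "P \<in> convex hull {a, b}" "P \<in> convex hull {a, c}" for P
  proof -
    obtain u v where uv: "0 \<le> u" "0 \<le> v" "u + v = 1" "P = u *\<^sub>R a + v *\<^sub>R b"
      using P(1) unfolding convex_hull_2 by auto
    obtain u' v' where uv': "0 \<le> u'" "0 \<le> v'" "u' + v' = 1" "P = u' *\<^sub>R a + v' *\<^sub>R c"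
      using P(2) unfolding convex_hull_2 by auto
    have "orient a b P = 0" using orient_affine[OF uv(3), of a b a b] uv by simp
    moreover have "orient a b P = v' * orient a b c"
      using orient_affine[OF uv'(3), of a b a c] uv' by simp
    ultimately have "v' = 0" using o by simp
    then show ?thesis using uv' by simp
  qed
  then show ?thesis unfolding edges_cross_def by blast
qed

section \<open>Cycles, and trees of depth two given by parent functions\<close>

lemma cycle_two_neighbours:
  assumes "length xs \<ge> 3" "distinct xs" "is_walk T xs" "{last xs, hd xs} \<in> T" "v \<in> set xs"
  shows "\<exists>a\<in>set xs. \<exists>b\<in>set xs. a \<noteq> b \<and> {v, a} \<in> T \<and> {v, b} \<in> T"
proof -
  define n where "n = length xs"
  have ne: "xs \<noteq> []" using assms(1) by auto
  have ends: "hd xs = xs ! 0" "last xs = xs ! (n - 1)"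
    using ne by (simp_all add: hd_conv_nth last_conv_nth n_def)
  have W: "\<And>i. Suc i < n \<Longrightarrow> {xs ! i, xs ! Suc i} \<in> T"
    using assms(3) unfolding is_walk_def n_def by simp
  have D: "\<And>i j. i < n \<Longrightarrow> j < n \<Longrightarrow> i \<noteq> j \<Longrightarrow> xs ! i \<noteq> xs ! j"
    using assms(2) unfolding n_def by (simp add: nth_eq_iff_index_eq)
  have S: "\<And>i. i < n \<Longrightarrow> xs ! i \<in> set xs" by (simp add: n_def)
  obtain i where i: "i < n" "v = xs ! i" using assms(5) by (auto simp: in_set_conv_nth n_def)
  have n3: "n \<ge> 3" using assms(1) n_def by simp
  consider "i = 0" | "i = n - 1" | "0 < i" "Suc i < n" using i n3 by linarith
  then show ?thesis
  proof cases
    case 1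
    have "{v, xs ! 1} \<in> T" "{v, xs ! (n - 1)} \<in> T"
      using W[of 0] assms(4) n3 1 i ends by (simp_all add: insert_commute)
    then show ?thesis using D[of 1 "n - 1"] S[of 1] S[of "n - 1"] n3 by fastforce
  next
    case 2
    have "{v, xs ! (n - 2)} \<in> T" "{v, xs ! 0} \<in> T"
      using W[of "n - 2"] assms(4) n3 2 i ends
      by (simp_all add: insert_commute Suc_diff_Suc numeral_2_eq_2)
    then show ?thesis using D[of 0 "n - 2"] S[of 0] S[of "n - 2"] n3 by fastforce
  next
    case 3
    then obtain j where j: "i = Suc j" by (cases i) auto
    have "{v, xs ! j} \<in> T" "{v, xs ! Suc i} \<in> T"
      using W[of j] W[of i] 3 i j by (simp_all add: insert_commute)
    then show ?thesis using D[of j "Suc i"] S[of j] S[of "Suc i"] 3 j i by fastforce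
  qed
qed

lemma finite_ex_max_nat:
  fixes r :: "'a \<Rightarrow> nat"
  assumes "finite A" "A \<noteq> {}"
  shows "\<exists>v\<in>A. \<forall>u\<in>A. r u \<le> r v"
proof -
  have "Max (r ` A) \<in> r ` A" using assms by simp
  then obtain v where "v \<in> A" "Max (r ` A) = r v" by blast
  then show ?thesis using Max_ge[OF finite_imageI[OF assms(1)], of _ r] by (metis imageI)
qed

text \<open>A vertex of maximal rank on a cycle has two distinct neighbours there, yet both would
  have to be its parent.\<close>

lemma acyclic_if_ranked:
  fixes r :: "point \<Rightarrow> nat"
  assumes "\<And>a b. {a, b} \<in> T \<Longrightarrow> (b = f a \<and> r b < r a) \<or> (a = f b \<and> r a < r b)"
  shows "\<not> has_cycle T"
proof
  assume "has_cycle T"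
  then obtain xs where xs: "length xs \<ge> 3" "distinct xs" "is_walk T xs" "{last xs, hd xs} \<in> T"
    unfolding has_cycle_def by blast
  have "finite (set xs)" "set xs \<noteq> {}" using xs(1) by auto
  then obtain v where v: "v \<in> set xs" "\<forall>u\<in>set xs. r u \<le> r v"
    using finite_ex_max_nat by blast
  obtain a b where "a \<in> set xs" "b \<in> set xs" "a \<noteq> b" "{v, a} \<in> T" "{v, b} \<in> T"
    using cycle_two_neighbours[OF xs v(1)] by blast
  then show False using assms v(2) by (metis leD)
qed

definition parent_edges :: "point set \<Rightarrow> point \<Rightarrow> (point \<Rightarrow> point) \<Rightarrow> edge set" where
  "parent_edges V c f = (\<lambda>v. {v, f v}) ` (V - {c})"

text \<open>Every vertex is within two steps of \<open>c\<close>, so going up to \<open>c\<close>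
  and down again gives diameter at most four. The depth is a rank that excludes cycles.\<close>

lemma depth2_tree:
  assumes c: "c \<in> V"
    and f: "\<And>v. v \<in> V \<Longrightarrow> v \<noteq> c \<Longrightarrow> f v \<in> V \<and> f v \<noteq> v \<and> (f v = c \<or> f (f v) = c)"
    and nc: "noncrossing (parent_edges V c f)"
  shows "parent_edges V c f \<in> trees_le V 4"
proof -
  let ?T = "parent_edges V c f"
  have E: "{v, f v} \<in> ?T" if "v \<in> V" "v \<noteq> c" for v
    using that unfolding parent_edges_def by blast
  have sub: "?T \<subseteq> complete_edges V"
    using f unfolding parent_edges_def complete_edges_def by fastforce
  have up: "\<exists>xs. is_walk ?T (xs @ [c]) \<and> is_walk ?T (c # rev xs) \<and> hd (xs @ [c]) = v
      \<and> last (c # rev xs) = v \<and> set xs \<subseteq> V \<and> length xs \<le> 2" if v: "v \<in> V" for v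
  proof -
    consider "v = c" | "v \<noteq> c" "f v = c" | "v \<noteq> c" "f v \<noteq> c" "f (f v) = c" using f v by blast
    then show ?thesis
    proof cases
      case 1
      then show ?thesis by (intro exI[of _ "[]"]) (simp add: is_walk_def)
    next
      case 2
      then show ?thesis using E[OF v] v
        by (intro exI[of _ "[v]"]) (simp add: is_walk_def insert_commute)
    next
      case 3
      then show ?thesis using E[OF v] E[of "f v"] f v
        by (intro exI[of _ "[v, f v]"])
           (auto simp: is_walk_def insert_commute nth_Cons' less_Suc_eq)
    qed
  qed
  have walk: "\<exists>xs. is_walk ?T xs \<and> hd xs = u \<and> last xs = v \<and> set xs \<subseteq> V \<and> length xs \<le> Suc 4"
    if u: "u \<in> V" and v: "v \<in> V" for u v
  proof -
    obtain xs where xs: "is_walk ?T (xs @ [c])" "hd (xs @ [c]) = u" "set xs \<subseteq> V" "length xs \<le> 2"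
      using up[OF u] by blast
    obtain ys where ys: "is_walk ?T (c # rev ys)" "last (c # rev ys) = v" "set ys \<subseteq> V" "length ys \<le> 2"
      using up[OF v] by blast
    \<comment> \<open>The root is counted once, so the walk has at most \<open>2 + 1 + 2\<close>
      vertices.\<close>
    let ?w = "xs @ c # rev ys"
    have "{?w ! i, ?w ! Suc i} \<in> ?T" if i: "Suc i < length ?w" for i
    proof (cases "i < length xs")
      case True
      then have "{(xs @ [c]) ! i, (xs @ [c]) ! Suc i} \<in> ?T" using xs(1) unfolding is_walk_def by simp
      moreover have "?w ! i = (xs @ [c]) ! i" "?w ! Suc i = (xs @ [c]) ! Suc i"
        using True by (auto simp: nth_append less_Suc_eq)
      ultimately show ?thesis by simp
    next
      case False
      then obtain k where k: "i = length xs + k" using le_Suc_ex by force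
      then have "{(c # rev ys) ! k, (c # rev ys) ! Suc k} \<in> ?T"
        using ys(1) i unfolding is_walk_def by simp
      moreover have "?w ! i = (c # rev ys) ! k" "?w ! Suc i = (c # rev ys) ! Suc k"
        using k by (simp_all add: nth_append)
      ultimately show ?thesis by simp
    qed
    then have "is_walk ?T ?w" unfolding is_walk_def by simp
    moreover have "hd ?w = u" using xs(2) by (cases xs) auto
    moreover have "last ?w = v" using ys(2) by simp
    ultimately show ?thesis using xs ys c by (intro exI[of _ ?w]) auto
  qed
  have "\<not> has_cycle ?T"
  proof (rule acyclic_if_ranked[where f = f])
    define r :: "point \<Rightarrow> nat" where "r v = (if v = c then 0 else if f v = c then 1 else 2)" for v
    fix a b assume "{a, b} \<in> ?T"
    then obtain u where u: "u \<in> V" "u \<noteq> c" "{a, b} = {u, f u}" unfolding parent_edges_def by blast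
    have "r (f u) < r u" using f[OF u(1,2)] u(2) unfolding r_def by auto
    then show "(b = f a \<and> r b < r a) \<or> (a = f b \<and> r a < r b)"
      using u(3) by (auto simp: doubleton_eq_iff)
  qed
  then show ?thesis using walk sub nc
    unfolding trees_le_def spanning_tree_def connected_graph_def diameter_le_def mem_Collect_eq
    by blast
qed

text \<open>General position already rules out crossings of edges with a common endpoint, so only
  disjoint pairs are left to check.\<close>

lemma parent_edges_noncrossing:
  assumes gp: "general_position V" and c: "c \<in> V"
    and f: "\<And>v. v \<in> V \<Longrightarrow> v \<noteq> c \<Longrightarrow> f v \<in> V \<and> f v \<noteq> v"
    and H: "\<And>u v. u \<in> V \<Longrightarrow> v \<in> V \<Longrightarrow> u \<noteq> c \<Longrightarrow> v \<noteq> c \<Longrightarrow> f u \<noteq> f v \<Longrightarrow> u \<noteq> f v \<Longrightarrow> v \<noteq> f u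
        \<Longrightarrow> \<not> edges_cross {u, f u} {v, f v}"
  shows "noncrossing (parent_edges V c f)"
proof -
  have sh: "\<not> edges_cross {a, b} {a, d}" if "a \<in> V" "b \<in> V" "d \<in> V" "a \<noteq> b" "a \<noteq> d" for a b d
    using shared_not_cross general_position_orient[OF gp] that by metis
  have "\<not> edges_cross {u, f u} {v, f v}" if u: "u \<in> V" "u \<noteq> c" and v: "v \<in> V" "v \<noteq> c" for u v
  proof -
    consider "f u = f v" | "u = f v" | "v = f u" | "f u \<noteq> f v" "u \<noteq> f v" "v \<noteq> f u" by blast
    then show ?thesis
    proof cases
      case 1 then show ?thesis using sh[of "f u" u v] f u v by (metis insert_commute)
    next
      case 2 then show ?thesis using sh[of u "f u" v] f u v by (metis insert_commute)
    next
      case 3 then show ?thesis using sh[of v u "f v"] f u v by (metis insert_commute)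
    next
      case 4 then show ?thesis using H u v by blast
    qed
  qed
  then show ?thesis unfolding noncrossing_def parent_edges_def by blast
qed

section \<open>The blocker as a rooted tree\<close>

locale blocker =
  fixes V :: "point set" and B :: "edge set"
  assumes finite_V: "finite V"
    and gp: "general_position V"
    and blocker: "is_blocker V (trees_le V 4) B"
begin

lemma B_edge: "{a, b} \<in> B \<Longrightarrow> a \<in> V \<and> b \<in> V \<and> a \<noteq> b"
  using blocker unfolding is_blocker_def complete_edges_def
  by (fastforce simp: doubleton_eq_iff)

lemma B_cases:
  assumes "e \<in> B"
  obtains a b where "e = {a, b}" "a \<in> V" "b \<in> V" "a \<noteq> b"
  using assms blocker unfolding is_blocker_def complete_edges_def by blast

lemma orient_nonzero: "a \<in> V \<Longrightarrow> b \<in> V \<Longrightarrow> c \<in> V \<Longrightarrow> a \<noteq> b \<Longrightarrow> a \<noteq> c \<Longrightarrow> b \<noteq> c \<Longrightarrow> orient a b c \<noteq> 0"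
  using general_position_orient[OF gp] by blast

lemma finite_B: "finite B"
proof (rule finite_subset)
  show "B \<subseteq> Pow V" using B_cases by blast
qed (simp add: finite_V)

lemma hits_tree: "T \<in> trees_le V 4 \<Longrightarrow> B \<inter> T \<noteq> {}"
  using blocker unfolding is_blocker_def blocks_def by blast

text \<open>Over no vertices the empty edge set would belong to the family, and nothing can meet
  it.\<close>

lemma V_nonempty: "V \<noteq> {}"
proof
  assume "V = {}"
  then have "{} \<in> trees_le V 4"
    unfolding trees_le_def spanning_tree_def connected_graph_def diameter_le_def noncrossing_def
      has_cycle_def by auto
  then show False using hits_tree by blast
qed

text \<open>The tool for forcing edges of \<open>B\<close>: a parent function of depth at most two
  without crossings gives a tree of the family, and \<open>B\<close> has to contain one of its
  edges.\<close>

lemma tree_hit: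
  assumes c: "c \<in> V"
    and f: "\<And>v. v \<in> V \<Longrightarrow> v \<noteq> c \<Longrightarrow> f v \<in> V \<and> f v \<noteq> v \<and> (f v = c \<or> f (f v) = c)"
    and H: "\<And>u v. u \<in> V \<Longrightarrow> v \<in> V \<Longrightarrow> u \<noteq> c \<Longrightarrow> v \<noteq> c \<Longrightarrow> f u \<noteq> f v \<Longrightarrow> u \<noteq> f v \<Longrightarrow> v \<noteq> f u
        \<Longrightarrow> \<not> edges_cross {u, f u} {v, f v}"
  obtains v where "v \<in> V" "v \<noteq> c" "{v, f v} \<in> B"
proof -
  have "noncrossing (parent_edges V c f)"
    by (rule parent_edges_noncrossing[OF gp c]) (use f H in auto)
  then have "parent_edges V c f \<in> trees_le V 4"
    using depth2_tree[OF c f] by blast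
  then show ?thesis using hits_tree that unfolding parent_edges_def by blast
qed

text \<open>The star at \<open>c\<close>, given by a constant parent function, is itself a tree that
  \<open>B\<close> has to hit.\<close>

lemma ex_neighbour:
  assumes "c \<in> V" obtains v where "{c, v} \<in> B"
  using tree_hit[OF assms, of "\<lambda>_. c"] assms by (metis insert_commute)

text \<open>A star meets every spanning tree, so minimality bounds \<open>B\<close> by its
  size.\<close>

lemma card_B: "card B \<le> card V - 1"
proof -
  obtain v where v: "v \<in> V" using V_nonempty by blast
  \<comment> \<open>The neighbour only supplies a second vertex, so that a walk from
    \<open>v\<close> to it has a first edge.\<close>
  obtain v' where v': "{v, v'} \<in> B" using ex_neighbour[OF v] .
  let ?S = "(\<lambda>w. {v, w}) ` (V - {v})"
  have "?S \<inter> T \<noteq> {}" if T: "T \<in> trees_le V 4" for T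
  proof -
    have sub: "T \<subseteq> complete_edges V" and "connected_graph V T"
      using T unfolding trees_le_def spanning_tree_def by auto
    then obtain xs where xs: "is_walk T xs" "hd xs = v" "last xs = v'"
      using B_edge[OF v'] unfolding connected_graph_def by blast
    then obtain a b ys where "xs = a # b # ys"
      using B_edge[OF v'] unfolding is_walk_def by (metis last_ConsL list.exhaust list.sel(1))
    then have e: "{v, b} \<in> T" using xs unfolding is_walk_def by force
    then have "b \<in> V - {v}" using sub unfolding complete_edges_def by (fastforce simp: doubleton_eq_iff)
    then show ?thesis using e by blast
  qed
  moreover have "?S \<subseteq> complete_edges V" using v unfolding complete_edges_def by blast
  ultimately have "card B \<le> card ?S" using blocker unfolding is_blocker_def blocks_def by blast
  also have "\<dots> \<le> card (V - {v})" by (rule card_image_le) (simp add: finite_V)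
  also have "\<dots> = card V - 1" using v finite_V by simp
  finally show ?thesis .
qed

section \<open>Leaves of the blocker\<close>

definition is_leaf :: "point \<Rightarrow> bool" where
  "is_leaf c \<longleftrightarrow> c \<in> V \<and> (\<exists>!x. {c, x} \<in> B)"

lemma not_leaf_two:
  assumes "v \<in> V" "\<not> is_leaf v"
  obtains a b where "{v, a} \<in> B" "{v, b} \<in> B" "a \<noteq> b"
  using assms ex_neighbour[OF assms(1)] unfolding is_leaf_def by blast

text \<open>Double counting of incidences: if all degrees were at least two, \<open>B\<close> would
  have at least \<open>card V\<close> edges, against \<open>card_B\<close>.\<close>

lemma ex_leaf: obtains c where "is_leaf c"
proof (rule ccontr)
  assume "\<not> thesis"
  then have nl: "\<not> is_leaf v" for v using that by blast
  have ge: "card {e \<in> B. v \<in> e} \<ge> 2" if v: "v \<in> V" for v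
  proof -
    obtain a b where ab: "{v, a} \<in> B" "{v, b} \<in> B" "a \<noteq> b" using not_leaf_two[OF v nl] .
    then have "{{v, a}, {v, b}} \<subseteq> {e \<in> B. v \<in> e}" by blast
    then have "card {{v, a}, {v, b}} \<le> card {e \<in> B. v \<in> e}" by (rule card_mono[rotated]) (simp add: finite_B)
    moreover have "{v, a} \<noteq> {v, b}" using ab by (auto simp: doubleton_eq_iff)
    ultimately show ?thesis by simp
  qed
  have "card {v \<in> V. v \<in> e} = 2" if e: "e \<in> B" for e
  proof -
    obtain a b where "e = {a, b}" "a \<in> V" "b \<in> V" "a \<noteq> b" using B_cases[OF e] .
    then have "{v \<in> V. v \<in> e} = {a, b}" by auto
    then show ?thesis using \<open>a \<noteq> b\<close> by simp
  qed
  then have "(\<Sum>v\<in>V. card {e \<in> B. v \<in> e}) = 2 * card B"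
    by (intro sum_multicount[OF finite_V finite_B]) auto
  moreover have "(\<Sum>v\<in>V. card {e \<in> B. v \<in> e}) \<ge> (\<Sum>v\<in>V. 2)" by (rule sum_mono) (use ge in auto)
  moreover have "card V > 0" using V_nonempty finite_V by (simp add: card_gt_0_iff)
  ultimately show False using card_B by simp
qed

end

text \<open>All four triples turn the same way, so the points are in convex position in this cyclic
  order: counterclockwise for positive \<open>s\<close>, clockwise for negative
  \<open>s\<close>.\<close>

definition convex_quad :: "real \<Rightarrow> point \<Rightarrow> point \<Rightarrow> point \<Rightarrow> point \<Rightarrow> bool" where
  "convex_quad s a b c d \<longleftrightarrow> s * orient a b c > 0 \<and> s * orient a b d > 0
     \<and> s * orient a c d > 0 \<and> s * orient b c d > 0"

section \<open>Rooting at a leaf: forced parents\<close>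

locale leaf_blocker = blocker +
  fixes c x :: point
  assumes c_V: "c \<in> V" and leaf: "\<And>y. {c, y} \<in> B \<longleftrightarrow> y = x"
begin

definition side :: "point \<Rightarrow> real" where "side z = sgn (orient c x z)"

lemma leaf': "{y, c} \<in> B \<longleftrightarrow> y = x"
  using leaf by (metis insert_commute)

lemma x_V: "x \<in> V" "x \<noteq> c" "c \<noteq> x"
  using B_edge[of c x] leaf by auto

lemma side_pos: "z \<in> V \<Longrightarrow> z \<noteq> c \<Longrightarrow> z \<noteq> x \<Longrightarrow> side z * orient c x z > 0"
  using orient_nonzero[OF c_V x_V(1), of z] x_V unfolding side_def
  by (metis mult.commute mult_sgn_abs sgn_mult zero_less_abs_iff abs_sgn)

lemma side_unique:
  assumes "side z * orient c x w > 0" shows "side w = side z"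
  using assms unfolding side_def by (auto simp: sgn_if zero_less_mult_iff split: if_splits)

text \<open>The witnessing tree: join everything to \<open>c\<close>, except that \<open>x\<close> and the points of the wedge
  between the rays \<open>cx\<close> and \<open>cz\<close> that lie beyond the line \<open>xz\<close> are joined to \<open>z\<close>.\<close>

lemma parent_exists:
  assumes z: "z \<in> V" "z \<noteq> c" "z \<noteq> x"
  shows "\<exists>w. {z, w} \<in> B \<and> w \<noteq> c \<and> (w = x \<or> convex_quad (side z) c x w z)"
proof -
  define s where "s = side z"
  \<comment> \<open>Orientations are normalised so that \<open>z\<close> lies on the positive side
    of the line \<open>cx\<close>.\<close>
  define D where "D a b d = s * orient a b d" for a b d
  define F where "F = {w. convex_quad s c x w z}"
  have swap: "D a d b = - D a b d" for a b d by (simp add: D_def orient_swap[of a d b])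
  have same: "D a a b = 0" "D a b a = 0" "D a b b = 0" for a b by (simp_all add: D_def)
  have rot: "D b d a = D a b d" for a b d by (simp add: D_def orient_rot[of b d a])
  have cxz: "D c x z > 0" using side_pos[OF z] by (simp add: D_def s_def)
  have F: "w \<in> F \<longleftrightarrow> D c x w > 0 \<and> D c w z > 0 \<and> D x w z > 0" for w
    using cxz by (auto simp: F_def convex_quad_def D_def)
  have Fd: "c \<notin> F" "x \<notin> F" "z \<notin> F" by (auto simp: F same)
  define f where "f u = (if u = x \<or> u \<in> F then z else c)" for u
  have nz: "D a b d \<noteq> 0" if "a \<in> V" "b \<in> V" "d \<in> V" "a \<noteq> b" "a \<noteq> d" "b \<noteq> d" for a b d
    using orient_nonzero[OF that] cxz by (auto simp: D_def)
  have NC: "\<not> edges_cross {u, c} {a, z}"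
    if u: "u \<in> V" "u \<noteq> c" "u \<noteq> x" "u \<notin> F" "u \<noteq> z" and a: "a = x \<or> a \<in> F" for u a
  proof -
    have a3: "D c z a < 0" "D x z a \<le> 0" "D c x a \<ge> 0"
      using a F[of a] cxz swap[of c z a] swap[of x z a] swap[of c z x] same by auto
    have xzc: "D x z c > 0" using rot[of x z c] cxz by simp
    \<comment> \<open>A vertex outside \<open>F\<close> violates one of its three inequalities, and
      the line of that inequality separates the two edges.\<close>
    consider "D c x u < 0" | "D c u z < 0" | "D x u z < 0"
      using F[of u] u nz[of c x u] nz[of c u z] nz[of x u z] c_V x_V z by fastforce
    then show ?thesis
    proof cases
      case 1
      then show ?thesis using separated_weak[of s c x u c a z] a3 cxz same by (simp add: D_def)
    next
      case 2
      then show ?thesis using separated_weak[of "-s" c z u c a z] a3 swap[of c z u] same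
        by (simp add: D_def)
    next
      case 3
      then have "\<not> edges_cross {a, z} {u, c}"
        using separated_strict[of s x z a z u c] a3 swap[of x z u] same xzc
        by (simp add: D_def)
      then show ?thesis using edges_cross_sym by blast
    qed
  qed
  obtain v where v: "v \<in> V" "v \<noteq> c" "{v, f v} \<in> B"
  proof (rule tree_hit[OF c_V, of f])
    fix u v
    assume uv: "u \<in> V" "v \<in> V" "u \<noteq> c" "v \<noteq> c" "f u \<noteq> f v" "u \<noteq> f v" "v \<noteq> f u"
    show "\<not> edges_cross {u, f u} {v, f v}"
    proof (cases "u = x \<or> u \<in> F")
      case True
      then have "f u = z" "f v = c" "v \<noteq> x" "v \<notin> F" using uv by (auto simp: f_def split: if_splits)
      then show ?thesis using NC[of v u] uv True edges_cross_sym by metis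
    next
      case False
      then have "f u = c" "f v = z" "v = x \<or> v \<in> F" using uv by (auto simp: f_def split: if_splits)
      then show ?thesis using NC[of u v] uv False by metis
    qed
  qed (use z c_V x_V Fd in \<open>auto simp: f_def\<close>)
  \<comment> \<open>A hit at \<open>c\<close> would have to be the edge \<open>{x, c}\<close>, but
    \<open>f\<close> sends \<open>x\<close> to \<open>z\<close>.\<close>
  then have "v = x \<or> v \<in> F" "f v = z" using leaf' by (auto simp: f_def split: if_splits)
  then show ?thesis using v x_V unfolding F_def s_def by (metis insert_commute mem_Collect_eq)
qed

text \<open>Fixes one forced neighbour per vertex. The vertex \<open>x\<close> is treated apart
  because its parent is the root \<open>c\<close>.\<close>

definition par :: "point \<Rightarrow> point" where
  "par z = (if z = x then c else
     SOME w. {z, w} \<in> B \<and> w \<noteq> c \<and> (w = x \<or> convex_quad (side z) c x w z))"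

lemma par_x [simp]: "par x = c" by (simp add: par_def)

lemma par:
  assumes "z \<in> V" "z \<noteq> c" "z \<noteq> x"
  shows "{z, par z} \<in> B" "par z \<noteq> c" "par z \<noteq> x \<Longrightarrow> convex_quad (side z) c x (par z) z"
  using someI_ex[OF parent_exists[OF assms]] assms unfolding par_def by auto

lemma par_edge: "z \<in> V \<Longrightarrow> z \<noteq> c \<Longrightarrow> {z, par z} \<in> B"
  using par(1) leaf' by (cases "z = x") auto

lemma par_side:
  assumes "z \<in> V" "z \<noteq> c" "z \<noteq> x" "par z \<noteq> x"
  shows "side (par z) = side z"
  using par(3)[OF assms] side_unique unfolding convex_quad_def by blast

text \<open>The angular order about \<open>c\<close> on each side of the line \<open>cx\<close>,
  counted away from the ray \<open>cx\<close>.\<close>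

definition before :: "point \<Rightarrow> point \<Rightarrow> bool" where
  "before w z \<longleftrightarrow> w \<noteq> c \<and> w \<noteq> x \<and> side w = side z \<and> side z * orient c w z > 0"

text \<open>The number of predecessors in the angular order, shifted by two to leave 0 for
  \<open>c\<close> and 1 for \<open>x\<close>. It is not the depth in the tree, but a rank that
  drops along \<open>par\<close>.\<close>

definition level :: "point \<Rightarrow> nat" where
  "level z = (if z = c then 0 else if z = x then 1 else 2 + card {w \<in> V. before w z})"

lemma before_trans:
  assumes "u \<in> V" "v \<in> V" "w \<in> V" "w \<noteq> c" "w \<noteq> x" "before u v" "before v w"
  shows "before u w"
  using assms side_pos[of u] side_pos[of v] side_pos[of w] orient_trans[of "side w" c x u v w]
  unfolding before_def by auto

text \<open>By transitivity every predecessor of \<open>u\<close> precedes \<open>v\<close>, and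
  \<open>u\<close> itself is one more.\<close>

lemma level_before:
  assumes "u \<in> V" "v \<in> V" "v \<noteq> c" "v \<noteq> x" "before u v"
  shows "level u < level v"
proof -
  have "{w \<in> V. before w u} \<subset> {w \<in> V. before w v}"
  proof
    show "{w \<in> V. before w u} \<subseteq> {w \<in> V. before w v}" using before_trans assms by blast
    have "u \<in> {w \<in> V. before w v}" "u \<notin> {w \<in> V. before w u}"
      using assms(1,5) by (simp_all add: before_def)
    then show "{w \<in> V. before w u} \<noteq> {w \<in> V. before w v}" by blast
  qed
  then have "card {w \<in> V. before w u} < card {w \<in> V. before w v}"
    by (rule psubset_card_mono[rotated]) (simp add: finite_V)
  then show ?thesis using assms unfolding level_def before_def by auto
qed

lemma par_before:
  assumes "z \<in> V" "z \<noteq> c" "z \<noteq> x" "par z \<noteq> x"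
  shows "before (par z) z"
  using par(2,3)[OF assms(1-3)] par_side[OF assms] assms(4) unfolding before_def convex_quad_def by auto

lemma par_V: "z \<in> V \<Longrightarrow> z \<noteq> c \<Longrightarrow> par z \<in> V"
  using par_edge B_edge by blast

lemma par_level:
  assumes "z \<in> V" "z \<noteq> c" shows "level (par z) < level z"
proof -
  consider "z = x" | "z \<noteq> x" "par z = x" | "z \<noteq> x" "par z \<noteq> x" by blast
  then show ?thesis
  proof cases
    case 1 then show ?thesis using x_V by (simp add: level_def)
  next
    case 2 then show ?thesis using assms x_V by (simp add: level_def)
  next
    case 3
    show ?thesis
      by (rule level_before) (use par_before par_V assms 3 in auto)
  qed
qed

text \<open>If two vertices had the same parent edge, each would be the parent of the other and
  \<open>level\<close> would drop both ways.\<close>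

lemma inj_parent_edge: "inj_on (\<lambda>z. {z, par z}) (V - {c})"
proof (rule inj_onI)
  fix u v assume uv: "u \<in> V - {c}" "v \<in> V - {c}" "{u, par u} = {v, par v}"
  then have "level (par u) < level u" "level (par v) < level v" using par_level by auto
  then show "u = v" using uv(3) by (auto simp: doubleton_eq_iff)
qed

lemma card_parent_edges: "card ((\<lambda>z. {z, par z}) ` (V - {c})) = card V - 1"
  using c_V finite_V inj_parent_edge by (simp add: card_image)

text \<open>The \<open>card V - 1\<close> edges forced by \<open>parent_exists\<close> exhaust the blocker, so it is a tree rooted at \<open>c\<close>.\<close>

lemma B_eq: "(\<lambda>z. {z, par z}) ` (V - {c}) = B"
proof (rule card_seteq[OF finite_B])
  show "(\<lambda>z. {z, par z}) ` (V - {c}) \<subseteq> B" using par_edge by blast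
qed (use card_parent_edges card_B in simp)

lemma adj_par:
  assumes "{a, b} \<in> B"
  shows "(a \<noteq> c \<and> b = par a) \<or> (b \<noteq> c \<and> a = par b)"
proof -
  have "{a, b} \<in> (\<lambda>z. {z, par z}) ` (V - {c})" using assms B_eq by simp
  then show ?thesis by (auto simp: doubleton_eq_iff)
qed

lemma par_induct [consumes 1, case_names root step]:
  assumes "z \<in> V" and "P c" and "\<And>z. z \<in> V \<Longrightarrow> z \<noteq> c \<Longrightarrow> P (par z) \<Longrightarrow> P z"
  shows "P z"
  using assms(1)
proof (induction "level z" arbitrary: z rule: less_induct)
  case less
  then show ?case using assms(2,3) par_level par_V by metis
qed

text \<open>Connectedness of \<open>B\<close> as a closure principle: climb from \<open>a\<close> to
  the root, then descend from the root to every vertex.\<close>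

lemma closed_under_adjacency:
  assumes "a \<in> K" "a \<in> V" and cl: "\<And>u v. u \<in> K \<Longrightarrow> {u, v} \<in> B \<Longrightarrow> v \<in> K"
  shows "V \<subseteq> K"
proof -
  have "u \<in> K \<longrightarrow> c \<in> K" if "u \<in> V" for u
    using that by (induction rule: par_induct) (use cl par_edge in blast)+
  then have cK: "c \<in> K" using assms by blast
  have "u \<in> K" if "u \<in> V" for u
    using that by (induction rule: par_induct) (use cl par_edge cK in \<open>metis insert_commute\<close>)+
  then show ?thesis by blast
qed

text \<open>Of two adjacent vertices one is the parent of the other, and their convex quadrilateral
  with \<open>c\<close> and \<open>x\<close> has both on one side of the line
  \<open>cx\<close>.\<close>

lemma leaf_same_side:
  assumes "{z, w} \<in> B" "z \<notin> {c, x}" "w \<notin> {c, x}"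
  shows "orient c x z * orient c x w > 0"
proof -
  have main: "orient c x z * orient c x w > 0"
    if "z \<in> V" "w = par z" "z \<notin> {c, x}" "w \<notin> {c, x}" for z w
    using par(3)[of z] that unfolding convex_quad_def by (auto simp: zero_less_mult_iff)
  have "z \<in> V" "w \<in> V" using B_edge assms by blast+
  then show ?thesis using adj_par[OF assms(1)] main assms(2,3) by (metis mult.commute)
qed

end

section \<open>Convexity along paths\<close>

text \<open>The Pluecker relation for the vectors from \<open>v\<close>. It carries the turn at
  \<open>v\<close> from the next vertex \<open>y\<close> of a convex chain over to a later vertex
  \<open>z\<close>.\<close>

lemma orient_turn:
  assumes "s * orient c p v > 0" "s * orient c v y > 0" "s * orient c v z > 0"
    and "s * orient p v y > 0" "s * orient v y z > 0"
  shows "s * orient p v z > 0"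
proof -
  have "(s * orient c v y) * (s * orient p v z)
      = (s * orient c v z) * (s * orient p v y) + (s * orient c p v) * (s * orient v y z)"
    unfolding orient_def by algebra
  also have "\<dots> > 0"
    by (rule add_pos_pos[OF mult_pos_pos[OF assms(3,4)] mult_pos_pos[OF assms(1,5)]])
  finally show ?thesis using assms(2) by (simp add: zero_less_mult_iff)
qed

context blocker
begin

lemma leafI: "d \<in> V \<Longrightarrow> (\<And>y. {d, y} \<in> B \<longleftrightarrow> y = k) \<Longrightarrow> leaf_blocker V B d k"
  by unfold_locales auto

text \<open>The hull-edge condition in terms of orientation. The factor \<open>s\<close> can be zero
  only if \<open>V\<close> has no point besides \<open>u\<close> and \<open>v\<close>.\<close>

definition one_side :: "point \<Rightarrow> point \<Rightarrow> bool" where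
  "one_side u v \<longleftrightarrow> (\<exists>s. \<forall>t\<in>V - {u, v}. s * orient u v t > 0)"

lemma one_side_sym: "one_side u v \<Longrightarrow> one_side v u"
proof -
  assume "one_side u v"
  then obtain s where s: "\<forall>t\<in>V - {u, v}. s * orient u v t > 0" unfolding one_side_def by blast
  have "orient v u p = - orient u v p" for p by (simp add: orient_def algebra_simps)
  then have "\<forall>t\<in>V - {v, u}. (-s) * orient v u t > 0" using s by auto
  then show "one_side v u" unfolding one_side_def by blast
qed

text \<open>For a tree edge \<open>uv\<close>, the component of \<open>v\<close> after removal of
  that edge: walks from \<open>v\<close> never step onto \<open>u\<close>.\<close>

definition branch :: "point \<Rightarrow> point \<Rightarrow> point set" where
  "branch u v = {s. (v, s) \<in> {(a, b). {a, b} \<in> B \<and> b \<noteq> u}\<^sup>*}"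

end

context leaf_blocker
begin

text \<open>With \<open>w\<close> the parent of \<open>z\<close> and \<open>q\<close> the parent of \<open>w\<close>, a reflex turn at \<open>w\<close> would allow a tree that
  avoids the blocker: join \<open>z\<close> and \<open>w\<close> to \<open>c\<close>, the point \<open>x\<close> to \<open>w\<close>, and split the wedge between \<open>cx\<close> and
  \<open>cz\<close> along the line \<open>qw\<close>. Points beyond that line, and \<open>q\<close> itself, go to \<open>z\<close>; the others go to \<open>w\<close> if
  they lie beyond the line \<open>xw\<close>, and to \<open>c\<close> otherwise.\<close>

lemma locally_convex:
  assumes z: "z \<in> V" "z \<noteq> c" "z \<noteq> x" and w: "par z \<noteq> x"
  shows "side z * orient (par (par z)) (par z) z > 0"
proof -
  define w where "w = par z"
  define q where "q = par w"
  define s where "s = side z"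
  define D where "D a b d = s * orient a b d" for a b d
  have swap: "D a d b = - D a b d" for a b d by (simp add: D_def orient_swap[of a d b])
  have same: "D a a b = 0" "D a b a = 0" "D a b b = 0" for a b by (simp_all add: D_def)
  have rot: "D b d a = D a b d" for a b d by (simp add: D_def orient_rot[of b d a])
  have trans: "D c u z > 0"
    if "D c x u > 0" "D c x w > 0" "D c x z > 0" "D c u w > 0" "D c w z > 0" for u
    using orient_trans[of s c x u w z] that by (simp add: D_def)
  have wV: "w \<in> V" "w \<noteq> c" "w \<noteq> x" using par_V par(2) z w by (auto simp: w_def)
  have sw: "side w = s" using par_side z w by (simp add: w_def s_def)
  have qV: "q \<in> V" "q \<noteq> c" using par_V par(2) wV by (auto simp: q_def)
  have rk: "level q < level w" "level w < level z" using par_level wV z by (auto simp: q_def w_def)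
  have zw: "D c x w > 0" "D c x z > 0" "D c w z > 0" "D x w z > 0"
    using par(3)[OF z w] by (auto simp: convex_quad_def D_def w_def s_def)
  have nz: "D a b d \<noteq> 0" if "a \<in> V" "b \<in> V" "d \<in> V" "a \<noteq> b" "a \<noteq> d" "b \<noteq> d" for a b d
    using orient_nonzero[OF that] zw by (auto simp: D_def)
  have "D q w z > 0"
  proof (cases "q = x")
    case True
    \<comment> \<open>Here the turn is one of the triples of the convex quadrilateral
      \<open>c, x, w, z\<close>.\<close>
    then show ?thesis using zw by simp
  next
    case False
    have wq: "D c x q > 0" "D c q w > 0" "D x q w > 0"
      using par(3)[OF wV] False sw by (auto simp: convex_quad_def D_def q_def)
    have cqz: "D c q z > 0" using trans wq zw by blast
    show ?thesis
    proof (rule ccontr)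
      assume "\<not> D q w z > 0"
      then have qwz: "D q w z < 0" using nz[of q w z] qV wV z rk by fastforce
      define Above where "Above u \<longleftrightarrow> D c x u > 0 \<and> D c u z > 0 \<and> (u = q \<or> D q w u < 0)" for u
      define Below where "Below u \<longleftrightarrow> D c x u > 0 \<and> D c u w > 0 \<and> D x u w > 0 \<and> D q w u > 0" for u
      define f where "f u = (if u = z \<or> u = w then c else if u = x \<or> Below u then w
          else if Above u then z else c)" for u
      have qwc: "D q w c > 0" using rot[of q w c] wq by simp
      have qwx: "D q w x > 0" using rot[of q w x] wq by simp
      have xwc: "D x w c > 0" using rot[of x w c] zw by simp
      have A: "D c x a > 0" "D c z a < 0" "D q w a \<le> 0" if "Above a" for a
        using that swap[of c z a] same by (auto simp: Above_def)
      have Bl: "D c x b \<ge> 0" "D c w b < 0" "D x w b \<le> 0" "D q w b > 0" if "b = x \<or> Below b" for b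
        using that swap[of c w b] swap[of x w b] swap[of c w x] same zw qwx by (auto simp: Below_def)
      have NCcz: "\<not> edges_cross {u, c} {a, z}"
        if u: "u \<in> V" "u \<noteq> c" "u \<noteq> z" "f u = c" and a: "Above a" for u a
      proof (cases "u = w")
        case True
        then have "\<not> edges_cross {a, z} {u, c}"
          using separated_weak[of s q w a z w c] A[OF a] qwc qwz same by (simp add: D_def)
        then show ?thesis using edges_cross_sym by blast
      next
        case False
        then have u': "u \<noteq> x" "\<not> Above u" using u wV z by (auto simp: f_def split: if_splits)
        then have uq: "u \<noteq> q" using wq cqz by (auto simp: Above_def)
        \<comment> \<open>Since \<open>u\<close> is not in \<open>Above\<close>, one of the lines
          \<open>cx\<close>, \<open>cz\<close>, \<open>qw\<close> separates the two edges.\<close>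
        consider "D c x u < 0" | "D c u z < 0" | "D q w u > 0"
          using u' nz[of c x u] nz[of c u z] nz[of q w u] c_V x_V z u qV wV rk False uq
          unfolding Above_def by fastforce
        then show ?thesis
        proof cases
          case 1
          then show ?thesis using separated_weak[of s c x u c a z] A[OF a] zw same by (simp add: D_def)
        next
          case 2
          then show ?thesis using separated_weak[of "-s" c z u c a z] A[OF a] swap[of c z u] same
            by (simp add: D_def)
        next
          case 3
          then have "\<not> edges_cross {a, z} {u, c}"
            using separated_strict[of s q w a z u c] A[OF a] qwz qwc by (simp add: D_def)
          then show ?thesis using edges_cross_sym by blast
        qed
      qed
      have NCcw: "\<not> edges_cross {u, c} {b, w}"
        if u: "u \<in> V" "u \<noteq> c" "u \<noteq> w" "f u = c" and b: "b = x \<or> Below b" for u b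
      proof -
        \<comment> \<open>A vertex other than \<open>z\<close> violating none of these would be in
          \<open>Below\<close> or, beyond the line \<open>qw\<close>, in \<open>Above\<close>; then
          it would not be joined to \<open>c\<close>.\<close>
        have "D c x u < 0 \<or> D c u w < 0 \<or> D x u w < 0"
        proof (cases "u = z")
          case True then show ?thesis using swap[of c z w] zw by simp
        next
          case False
          then have u': "u \<noteq> x" "\<not> Above u" "\<not> Below u" using u wV z by (auto simp: f_def split: if_splits)
          then have uq: "u \<noteq> q" using wq cqz by (auto simp: Above_def)
          show ?thesis
          proof (rule ccontr)
            assume n: "\<not> ?thesis"
            then have p: "D c x u > 0" "D c u w > 0" "D x u w > 0"
              using nz[of c x u] nz[of c u w] nz[of x u w] c_V x_V wV u u' by fastforce+
            then have "D q w u < 0"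
              using u' nz[of q w u] qV wV u uq rk unfolding Below_def by fastforce
            moreover have "D c u z > 0" using trans p zw by blast
            ultimately show False using u' p unfolding Above_def by blast
          qed
        qed
        then consider "D c x u < 0" | "D c u w < 0" | "D x u w < 0" by blast
        then show ?thesis
        proof cases
          case 1
          then show ?thesis using separated_weak[of s c x u c b w] Bl[OF b] zw same by (simp add: D_def)
        next
          case 2
          then show ?thesis using separated_weak[of "-s" c w u c b w] Bl[OF b] swap[of c w u] same
            by (simp add: D_def)
        next
          case 3
          then have "\<not> edges_cross {b, w} {u, c}"
            using separated_strict[of s x w b w u c] Bl[OF b] swap[of x w u] xwc same by (simp add: D_def)
          then show ?thesis using edges_cross_sym by blast
        qed
      qed
      have NCzw: "\<not> edges_cross {a, z} {b, w}" if a: "Above a" and b: "b = x \<or> Below b" for a b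
        using separated_weak[of s q w a z b w] A[OF a] Bl[OF b] qwz same by (simp add: D_def)
      have fz: "Above u" if "f u = z" for u using that z wV rk by (auto simp: f_def split: if_splits)
      have fw: "u = x \<or> Below u" if "f u = w" for u using that z wV rk by (auto simp: f_def split: if_splits)
      have fcases: "f u = c \<or> f u = z \<or> f u = w" for u by (simp add: f_def)
      obtain v where v: "v \<in> V" "v \<noteq> c" "{v, f v} \<in> B"
      proof (rule tree_hit[OF c_V, of f])
        fix u assume "u \<in> V" "u \<noteq> c"
        have "f u \<noteq> u" using \<open>u \<noteq> c\<close> A(2)[of u] Bl(2)[of u] fz[of u] fw[of u] same wV z by (metis fcases less_irrefl)
        then show "f u \<in> V \<and> f u \<noteq> u \<and> (f u = c \<or> f (f u) = c)"
          using fcases[of u] c_V wV z by (auto simp: f_def)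
      next
        fix u v
        assume uv: "u \<in> V" "v \<in> V" "u \<noteq> c" "v \<noteq> c" "f u \<noteq> f v" "u \<noteq> f v" "v \<noteq> f u"
        consider "f u = c" "f v = z" | "f u = c" "f v = w" | "f u = z" "f v = w"
          | "f v = c" "f u = z" | "f v = c" "f u = w" | "f v = z" "f u = w"
          using fcases[of u] fcases[of v] uv(5) by metis
        then show "\<not> edges_cross {u, f u} {v, f v}"
        proof cases
          case 1 then show ?thesis using NCcz[of u v] fz[of v] uv by simp
        next
          case 2 then show ?thesis using NCcw[of u v] fw[of v] uv by simp
        next
          case 3 then show ?thesis using NCzw[of u v] fz[of u] fw[of v] by simp
        next
          case 4 then show ?thesis using NCcz[of v u] fz[of u] uv edges_cross_sym by metis
        next
          case 5 then show ?thesis using NCcw[of v u] fw[of u] uv edges_cross_sym by metis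
        next
          case 6 then show ?thesis using NCzw[of v u] fz[of v] fw[of u] edges_cross_sym by metis
        qed
      qed
      \<comment> \<open>Each hit is impossible. At \<open>c\<close> only \<open>x\<close> is a
        neighbour, and \<open>x\<close> was sent to \<open>w\<close>. At \<open>z\<close> or
        \<open>w\<close> the vertex \<open>v\<close> would be a child, hence later in the angular
        order, whereas \<open>Above\<close> and \<open>Below\<close> place it earlier.\<close>
      consider "f v = c" | "f v = z" | "f v = w" using fcases by blast
      then show False
      proof cases
        case 1
        then have "v = x" using v leaf' by simp
        then show False using 1 wV z by (simp add: f_def)
      next
        case 2
        then have av: "Above v" using fz by simp
        then have vx: "v \<noteq> x" "v \<noteq> w" using A[OF av] same nz[of c x v] rk by (auto simp: Above_def)
        then have "z = par v" using adj_par[OF v(3)] 2 w_def by auto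
        then have "before z v" using par_before[OF v(1,2) vx(1)] z by simp
        then have "D c z v > 0" by (simp add: before_def D_def s_def)
        then show False using A[OF av] by simp
      next
        case 3
        then have bv: "v = x \<or> Below v" using fw by simp
        then have vq: "v \<noteq> q" using Bl(4)[OF bv] same by auto
        then have "w = par v" using adj_par[OF v(3)] 3 q_def by auto
        moreover from this have vx: "v \<noteq> x" using wV by auto
        ultimately have "before w v" using par_before[OF v(1,2) vx] wV by simp
        then have "D c w v > 0" using sw by (simp add: before_def D_def)
        then show False using Bl[OF bv] by simp
      qed
    qed
  qed
  then show ?thesis by (simp add: D_def q_def w_def s_def)
qed

section \<open>Descendants and branches\<close>

definition parent_rel :: "(point \<times> point) set" where
  "parent_rel = {(z, par z) | z. z \<in> V \<and> z \<noteq> c}"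

lemma desc_before:
  assumes "(t, v) \<in> parent_rel\<^sup>+" "v \<noteq> c" "v \<noteq> x"
  shows "t \<in> V \<and> t \<noteq> c \<and> t \<noteq> x \<and> v \<in> V \<and> before v t"
  using assms
proof (induction rule: trancl_induct)
  case (base y)
  then have t: "t \<in> V" "t \<noteq> c" "y = par t" "t \<noteq> x" by (auto simp: parent_rel_def)
  then show ?case using par_before[of t] par_V[of t] base by auto
next
  case (step y v)
  then have y: "y \<in> V" "y \<noteq> c" "v = par y" "y \<noteq> x" by (auto simp: parent_rel_def)
  then have "before v y" using par_before[of y] step by auto
  then show ?case using before_trans[of v y t] step y par_V[of y] by auto
qed

lemma desc_level: "(t, v) \<in> parent_rel\<^sup>+ \<Longrightarrow> level v < level t"
proof (induction rule: trancl_induct)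
  case (base y) then show ?case using par_level by (auto simp: parent_rel_def)
next
  case (step y v) then show ?case using par_level[of y] by (auto simp: parent_rel_def)
qed

text \<open>Induction upwards from \<open>t\<close>: with the local convexity at \<open>v\<close>,
  \<open>orient_turn\<close> passes from the edge below \<open>v\<close> to the edge above
  it.\<close>

lemma desc_side_edge:
  assumes "(t, v) \<in> parent_rel\<^sup>+" "v \<noteq> c" "v \<noteq> x"
  shows "side t * orient (par v) v t > 0"
  using assms
proof (induction rule: trancl_induct)
  case (base y)
  then have t: "t \<in> V" "t \<noteq> c" "y = par t" "t \<noteq> x" by (auto simp: parent_rel_def)
  then show ?case using locally_convex[of t] base by auto
next
  case (step y v)
  then have y: "y \<in> V" "y \<noteq> c" "v = par y" "y \<noteq> x" by (auto simp: parent_rel_def)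
  have by': "before y t" "t \<in> V" "t \<noteq> c" "t \<noteq> x" using desc_before step y by blast+
  have bv: "before v y" using par_before[of y] step y by auto
  have bvt: "before v t" using before_trans[of v y t] bv by' y par_V[of y] by auto
  have s: "side y = side t" "side v = side t" using by' bvt by (auto simp: before_def)
  have v: "v \<in> V" using par_V y by auto
  have "side t * orient c (par v) v > 0"
    using par(3)[of v] side_pos[of v] step v s by (cases "par v = x") (auto simp: convex_quad_def)
  moreover have "side t * orient c v y > 0" "side t * orient c v t > 0"
    using bv bvt s by (auto simp: before_def)
  moreover have "side t * orient (par v) v y > 0" using locally_convex[of y] y step s by auto
  moreover have "side t * orient v y t > 0" using step.IH y by auto
  ultimately show ?case by (rule orient_turn)
qed

text \<open>The sign \<open>side t\<close> describes both the position of \<open>t\<close> and that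
  of \<open>c\<close> relative to the edge above \<open>v\<close>.\<close>

lemma desc_same_side:
  assumes "(t, v) \<in> parent_rel\<^sup>+" "v \<noteq> c" "v \<noteq> x"
  shows "orient (par v) v t * orient (par v) v c > 0"
proof -
  have b: "v \<in> V" "before v t" using desc_before[OF assms] by auto
  then have s: "side v = side t" by (simp add: before_def)
  have "side t * orient c (par v) v > 0"
    using par(3)[of v] side_pos[of v] assms b s by (cases "par v = x") (auto simp: convex_quad_def)
  then have "side t * orient (par v) v c > 0" using orient_rot[of "par v" v c] by simp
  then show ?thesis using desc_side_edge[OF assms] by (auto simp: zero_less_mult_iff)
qed

lemma branch_desc:
  assumes "t \<in> branch (par v) v"
  shows "t = v \<or> (t, v) \<in> parent_rel\<^sup>+"
proof -
  have "(v, t) \<in> {(a, b). {a, b} \<in> B \<and> b \<noteq> par v}\<^sup>*" using assms by (simp add: branch_def)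
  then show ?thesis
  proof (induction rule: rtrancl_induct)
    case base then show ?case by simp
  next
    case (step y t)
    then have yt: "{y, t} \<in> B" "t \<noteq> par v" by auto
    then have V: "y \<in> V" "t \<in> V" using B_edge by blast+
    consider "t = par y" | "t \<noteq> c" "y = par t" using adj_par[OF yt(1)] by blast
    then show ?case
    proof cases
      case 1
      \<comment> \<open>As \<open>t\<close> is not \<open>par v\<close>, a step upwards starts at a
        proper descendant and ends at \<open>v\<close> or at another one.\<close>
      then have "(y, v) \<in> parent_rel\<^sup>+" using step.IH yt by auto
      then obtain k where "(y, k) \<in> parent_rel" "k = v \<or> (k, v) \<in> parent_rel\<^sup>+"
        by (cases rule: converse_tranclE) auto
      then show ?thesis using 1 by (auto simp: parent_rel_def)
    next
      case 2
      then have "(t, y) \<in> parent_rel" using V by (auto simp: parent_rel_def)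
      then show ?thesis using step.IH by (auto intro: trancl_into_trancl2)
    qed
  qed
qed

lemma desc_branch:
  assumes "(t, v) \<in> parent_rel\<^sup>+" "v \<in> V" "v \<noteq> c"
  shows "t \<in> branch (par v) v"
  using assms(1)
proof (induction rule: converse_trancl_induct)
  case (base y)
  have "level v < level y" using base desc_level by blast
  then have "y \<noteq> par v" using par_level[OF assms(2,3)] by auto
  moreover have "{v, y} \<in> B" using base par_edge by (auto simp: parent_rel_def insert_commute)
  ultimately show ?case unfolding branch_def by auto
next
  case (step y k)
  have "level v < level y" using step desc_level by (meson less_trans r_into_trancl)
  then have "y \<noteq> par v" using par_level[OF assms(2,3)] by auto
  moreover have "{k, y} \<in> B" using step par_edge by (auto simp: parent_rel_def insert_commute)
  ultimately show ?case using step.IH unfolding branch_def by (auto intro: rtrancl_into_rtrancl)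
qed

lemma root_notin_branch: "v \<noteq> c \<Longrightarrow> c \<notin> branch (par v) v"
  using branch_desc[of c v] by (auto simp: parent_rel_def elim: converse_tranclE)

text \<open>The union is closed under adjacency: a walk stopped at one end of the edge continues in
  the branch of that end.\<close>

lemma branch_union:
  assumes "{u, v} \<in> B" shows "V \<subseteq> branch u v \<union> branch v u"
proof (rule closed_under_adjacency)
  show "v \<in> branch u v \<union> branch v u" by (simp add: branch_def)
  show "v \<in> V" using B_edge assms by blast
  fix a b assume ab: "a \<in> branch u v \<union> branch v u" "{a, b} \<in> B"
  have "u \<in> branch v u" "v \<in> branch u v" by (simp_all add: branch_def)
  then show "b \<in> branch u v \<union> branch v u"
    using ab unfolding branch_def by (cases "b = u"; cases "b = v") (auto intro: rtrancl_into_rtrancl)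
qed

text \<open>Root the tree at a leaf on either side of the edge: the convexity seen from one root controls
  the branch containing the other.\<close>

lemma inner_edge_one_side_aux:
  assumes uv: "v \<in> V" "v \<noteq> c" "u = par v" and nl: "\<not> is_leaf u" "\<not> is_leaf v"
  shows "one_side u v"
proof -
  have lc: "is_leaf c" using leaf c_V unfolding is_leaf_def by auto
  then have uc: "u \<noteq> c" and vx: "v \<noteq> x" using nl uv par_x by auto
  define S where "S = {t. (t, v) \<in> parent_rel\<^sup>+}"
  have uvB: "{u, v} \<in> B" using par_edge uv by (metis insert_commute)
  obtain a b where ab: "{v, a} \<in> B" "{v, b} \<in> B" "a \<noteq> b" using not_leaf_two[OF uv(1) nl(2)] .
  then obtain k where k: "{v, k} \<in> B" "k \<noteq> par v" by metis
  then have "k \<noteq> c" "v = par k" using adj_par[OF k(1)] by auto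
  then have "(k, v) \<in> parent_rel" using B_edge[OF k(1)] by (auto simp: parent_rel_def)
  then have "S \<noteq> {}" unfolding S_def by blast
  moreover have SV: "S \<subseteq> V" using desc_before uv(2) vx unfolding S_def by blast
  \<comment> \<open>A child has larger \<open>level\<close> than its parent, so a descendant of
    maximal level has no child and is a leaf.\<close>
  ultimately obtain d where d: "d \<in> S" "\<forall>t\<in>S. level t \<le> level d"
    using finite_ex_max_nat[of S level] finite_subset[OF _ finite_V] by blast
  have dV: "d \<in> V" "d \<noteq> c" using SV d(1) desc_before uv(2) vx unfolding S_def by blast+
  have dl: "{d, y} \<in> B \<longleftrightarrow> y = par d" for y
  proof
    assume dy: "{d, y} \<in> B"
    show "y = par d"
    proof (rule ccontr)
      assume "y \<noteq> par d"
      then have "y \<noteq> c" "d = par y" using adj_par[OF dy] by auto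
      then have yd: "(y, d) \<in> parent_rel" using B_edge[OF dy] by (auto simp: parent_rel_def)
      then have "y \<in> S" using d(1) unfolding S_def by auto
      then show False using d(2) desc_level[OF r_into_trancl[OF yd]] by auto
    qed
  qed (use par_edge dV in simp)
  interpret d: leaf_blocker V B d "par d" using leafI[OF dV(1) dl] .
  have dbranch: "d \<in> branch u v" using d(1) desc_branch uv unfolding S_def by auto
  have ld: "is_leaf d" using dl dV unfolding is_leaf_def by auto
  then have dne: "d \<noteq> u" "d \<noteq> v" using nl by auto
  \<comment> \<open>Seen from \<open>d\<close>, which lies in the branch of \<open>v\<close>, the
    edge is reversed: \<open>v\<close> is the parent of \<open>u\<close>.\<close>
  have "u \<noteq> d.par v"
  proof
    assume "u = d.par v" then show False using d.root_notin_branch[of v] dbranch dne by auto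
  qed
  then have vd: "v = d.par u" using d.adj_par[OF uvB] by auto
  have "u \<noteq> par d"
  proof
    assume "u = par d" then show False using vd d.par_x dne by auto
  qed
  then have side_d: "orient v u t * orient v u d > 0" if "t \<in> branch v u" "t \<noteq> u" for t
    using d.desc_same_side[of t u] d.branch_desc[of t u] that vd dne by auto
  have side_c: "orient u v t * orient u v c > 0" if "t \<in> branch u v" "t \<noteq> v" for t
    using desc_same_side[of t v] branch_desc[of t v] that uv vx by auto
  \<comment> \<open>Since \<open>d\<close> lies in the branch of \<open>v\<close>, it is on the side
    of \<open>c\<close>, so the conditions from the two roots name the same side.\<close>
  have "orient u v c * orient u v t > 0" if t: "t \<in> V" "t \<noteq> u" "t \<noteq> v" for t
  proof (cases "t \<in> branch u v")
    case True then show ?thesis using side_c[OF _ t(3)] by (metis mult.commute)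
  next
    case False
    then have "orient v u t * orient v u d > 0" using side_d branch_union[OF uvB] t by auto
    moreover have "orient v u p = - orient u v p" for p by (simp add: orient_def algebra_simps)
    moreover have "orient u v d * orient u v c > 0" using side_c dbranch dne by blast
    ultimately show ?thesis by (auto simp: zero_less_mult_iff)
  qed
  then show ?thesis unfolding one_side_def by blast
qed

end

section \<open>Hull edges and the spine\<close>

text \<open>A supporting line at the midpoint of a boundary segment contains the segment.
  Conversely, if \<open>V\<close> lies in a closed half-plane of the line \<open>uv\<close>, no
  point of this line is interior to the hull.\<close>

lemma one_side_frontier_iff:
  assumes V: "finite V" "general_position V" and u: "u \<in> V" and v: "v \<in> V" and ne: "u \<noteq> v"
  shows "convex hull {u, v} \<subseteq> frontier (convex hull V)
    \<longleftrightarrow> (\<exists>s. \<forall>t\<in>V - {u, v}. s * orient u v t > 0)"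
proof
  assume fr: "convex hull {u, v} \<subseteq> frontier (convex hull V)"
  define m where "m = (1/2) *\<^sub>R u + (1/2) *\<^sub>R v"
  have "m \<in> convex hull {u, v}" unfolding m_def convex_hull_2 by force
  then have m: "m \<in> closure (convex hull V)" "m \<notin> interior (convex hull V)"
    using fr unfolding frontier_def by auto
  obtain a where a: "a \<noteq> 0" "\<And>y. y \<in> V \<Longrightarrow> a \<bullet> m \<le> a \<bullet> y"
  \<comment> \<open>A hull without interior lies in a line, which then serves as supporting
    line.\<close>
  proof (cases "interior (convex hull V) = {}")
    case True
    then obtain a b where ab: "a \<noteq> 0" "convex hull V \<subseteq> {x. a \<bullet> x = b}"
      using empty_interior_subset_hyperplane[of "convex hull V"] by auto
    have "m \<in> convex hull V" using m(1) compact_convex_hull[OF finite_imp_compact[OF V(1)]]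
      by (simp add: compact_imp_closed)
    then have "a \<bullet> m = b" "\<And>y. y \<in> V \<Longrightarrow> a \<bullet> y = b" using ab(2) hull_subset[of V convex] by auto
    then show ?thesis using that[of a] ab(1) by simp
  next
    case False
    then have mr: "m \<notin> rel_interior (convex hull V)" using m(2) rel_interior_nonempty_interior by blast
    show ?thesis
    proof (rule supporting_hyperplane_relative_frontier[OF convex_convex_hull m(1) mr])
      fix a :: point
      assume "a \<noteq> 0" and h: "\<And>y. y \<in> closure (convex hull V) \<Longrightarrow> a \<bullet> m \<le> a \<bullet> y"
      then show thesis
        using that[of a] closure_subset[of "convex hull V"] hull_subset[of V convex] by blast
    qed
  qed
  have "a \<bullet> u + a \<bullet> v = 2 * (a \<bullet> m)" by (simp add: m_def inner_add_right)
  \<comment> \<open>The midpoint minimises the functional, so neither endpoint can exceed the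
    average.\<close>
  then have eq: "a \<bullet> u = a \<bullet> m" "a \<bullet> v = a \<bullet> m" using a(2)[OF u] a(2)[OF v] by auto
  have in2: "a \<bullet> y = a$1 * y$1 + a$2 * y$2" for y by (simp add: inner_vec_def sum_2)
  define d where "d = v - u"
  have da: "a$1 * d$1 + a$2 * d$2 = 0" using eq in2 by (simp add: d_def algebra_simps)
  \<comment> \<open>In the plane, a vector orthogonal to \<open>d\<close> is a multiple of
    \<open>d\<close> turned by a right angle. This makes the functional a multiple of
    \<open>orient u v\<close> up to a constant.\<close>
  have "\<exists>k. a$1 = - k * d$2 \<and> a$2 = k * d$1"
  proof (cases "d$1 = 0")
    case True
    then have "d$2 \<noteq> 0" using ne by (auto simp: d_def vec_eq_iff forall_2)
    then show ?thesis using True da by (intro exI[of _ "- a$1 / d$2"]) simp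
  next
    case False
    then have "a$1 = - (a$2 / d$1) * d$2" using da by (simp add: field_simps)
    then show ?thesis using False by (intro exI[of _ "a$2 / d$1"]) simp
  qed
  then obtain k where k: "a$1 = - k * d$2" "a$2 = k * d$1" by blast
  have k0: "k \<noteq> 0" using k a(1) by (auto simp: vec_eq_iff forall_2)
  have "k * orient u v t > 0" if t: "t \<in> V - {u, v}" for t
  proof -
    have "k * orient u v t = a \<bullet> t - a \<bullet> u"
      unfolding in2 k orient_def by (simp add: d_def algebra_simps)
    also have "\<dots> \<ge> 0" using a(2)[of t] eq t by simp
    finally have "k * orient u v t \<ge> 0" .
    moreover have "orient u v t \<noteq> 0" using general_position_orient[OF V(2) u v] t ne by auto
    ultimately show ?thesis using k0 by (simp add: less_le)
  qed
  then show "\<exists>s. \<forall>t\<in>V - {u, v}. s * orient u v t > 0" by blast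
next
  assume "\<exists>s. \<forall>t\<in>V - {u, v}. s * orient u v t > 0"
  then obtain s0 where s0: "\<forall>t\<in>V - {u, v}. s0 * orient u v t > 0" by blast
  \<comment> \<open>The given factor may be zero when there is no third point; the weak inequality
    then holds for \<open>s = 1\<close>.\<close>
  obtain s where s: "s \<noteq> 0" "\<forall>t\<in>V. s * orient u v t \<ge> 0"
  proof (cases "s0 = 0")
    case True
    then have "V \<subseteq> {u, v}" using s0 by auto
    then have "\<forall>t\<in>V. 1 * orient u v t \<ge> 0" by auto
    then show ?thesis using that[of 1] by simp
  next
    case False
    have "s0 * orient u v t \<ge> 0" if "t \<in> V" for t
      using s0 that by (cases "t \<in> {u, v}") (auto intro: less_imp_le)
    then show ?thesis using that[of s0] False by blast
  qed
  \<comment> \<open>A normal of the line \<open>uv\<close>, scaled so that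
    \<open>a \<bullet> y - a \<bullet> u\<close> equals \<open>s * orient u v y\<close>.\<close>
  define a :: point where "a = s *\<^sub>R (vector [u$2 - v$2, v$1 - u$1])"
  have in2: "a \<bullet> y = a$1 * y$1 + a$2 * y$2" for y by (simp add: inner_vec_def sum_2)
  have ay: "a \<bullet> y = s * orient u v y + a \<bullet> u" for y
    unfolding in2 orient_def by (simp add: a_def algebra_simps)
  have a0: "a \<noteq> 0" using s(1) ne by (auto simp: a_def vec_eq_iff forall_2)
  have "convex hull V \<subseteq> {y. a \<bullet> y \<ge> a \<bullet> u}"
  proof (rule hull_minimal)
    show "V \<subseteq> {y. a \<bullet> y \<ge> a \<bullet> u}"
    proof
      fix y assume "y \<in> V"
      then have "a \<bullet> u \<le> a \<bullet> y" using s(2) unfolding ay[of y] by simp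
      then show "y \<in> {y. a \<bullet> y \<ge> a \<bullet> u}" by blast
    qed
  qed (rule convex_halfspace_ge)
  then have int: "interior (convex hull V) \<subseteq> {y. a \<bullet> y > a \<bullet> u}"
    using interior_mono interior_halfspace_ge[OF a0] by blast
  have "P \<in> frontier (convex hull V)" if P: "P \<in> convex hull {u, v}" for P
  proof -
    have "P \<in> convex hull V" using P u v hull_mono[of "{u, v}" V convex] by blast
    moreover obtain k l where kl: "k + l = 1" "P = k *\<^sub>R u + l *\<^sub>R v" using P unfolding convex_hull_2 by blast
    have "orient u v P = 0" using orient_affine[OF kl(1), of u v u v] kl(2) by simp
    then have "P \<notin> interior (convex hull V)" using int ay[of P] by auto
    ultimately show ?thesis unfolding frontier_def using closure_subset by blast
  qed
  then show "convex hull {u, v} \<subseteq> frontier (convex hull V)" by blast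
qed

context blocker
begin

lemma is_leafD:
  assumes "is_leaf c" obtains x where "leaf_blocker V B c x"
proof -
  obtain x where x: "c \<in> V" "{c, x} \<in> B" "\<And>y. {c, y} \<in> B \<Longrightarrow> y = x"
    using assms unfolding is_leaf_def by blast
  then have "{c, y} \<in> B \<longleftrightarrow> y = x" for y by blast
  then show ?thesis using that leafI x(1) by blast
qed

lemma leaf_unique: "is_leaf c \<Longrightarrow> {c, a} \<in> B \<Longrightarrow> {c, b} \<in> B \<Longrightarrow> a = b"
  unfolding is_leaf_def by blast

lemma inner_edge_one_side:
  assumes uv: "{u, v} \<in> B" "\<not> is_leaf u" "\<not> is_leaf v"
  shows "one_side u v"
proof -
  obtain c where "is_leaf c" using ex_leaf .
  then obtain x where "leaf_blocker V B c x" using is_leafD by blast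
  then interpret leaf_blocker V B c x .
  have "u \<in> V" "v \<in> V" using B_edge uv by blast+
  then show ?thesis
    using adj_par[OF uv(1)] inner_edge_one_side_aux[of v u] inner_edge_one_side_aux[of u v]
      uv one_side_sym by metis
qed

lemma B_acyclic: "\<not> has_cycle B"
proof -
  obtain c where "is_leaf c" using ex_leaf .
  then obtain x where "leaf_blocker V B c x" using is_leafD by blast
  then interpret leaf_blocker V B c x .
  show ?thesis
  proof (rule acyclic_if_ranked[where f = par and r = level])
    fix a b assume ab: "{a, b} \<in> B"
    then have "a \<in> V" "b \<in> V" using B_edge by blast+
    then show "(b = par a \<and> level b < level a) \<or> (a = par b \<and> level a < level b)"
      using adj_par[OF ab] par_level by blast
  qed
qed

lemma connected_closed:
  assumes "a \<in> K" "a \<in> V" and cl: "\<And>u v. u \<in> K \<Longrightarrow> {u, v} \<in> B \<Longrightarrow> v \<in> K"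
  shows "V \<subseteq> K"
proof -
  obtain c where "is_leaf c" using ex_leaf .
  then obtain x where "leaf_blocker V B c x" using is_leafD by blast
  then show ?thesis using leaf_blocker.closed_under_adjacency[of V B c x a K] assms by blast
qed

text \<open>The star at \<open>y\<close> already has \<open>card V - 1\<close> edges, and
  \<open>B\<close> has no more.\<close>

lemma star_if_adjacent:
  assumes y: "y \<in> V" and adj: "\<And>v. v \<in> V \<Longrightarrow> v \<noteq> y \<Longrightarrow> {y, v} \<in> B"
  shows "is_star V B"
proof -
  have "inj_on (\<lambda>v. {y, v}) (V - {y})" by (auto simp: inj_on_def doubleton_eq_iff)
  then have "card ((\<lambda>v. {y, v}) ` (V - {y})) = card V - 1"
    using y finite_V by (simp add: card_image)
  moreover have "(\<lambda>v. {y, v}) ` (V - {y}) \<subseteq> B" using adj by blast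
  ultimately have "(\<lambda>v. {y, v}) ` (V - {y}) = B"
    using card_seteq[OF finite_B] card_B by metis
  then have "B = {{y, w} |w. w \<in> V \<and> w \<noteq> y}" by blast
  then show ?thesis using y unfolding is_star_def by blast
qed

text \<open>If all neighbours of \<open>y\<close> were leaves, \<open>y\<close> and its neighbours
  would be closed under adjacency, hence all of \<open>V\<close>, and \<open>B\<close> a
  star.\<close>

lemma inner_neighbour:
  assumes "\<not> is_star V B" and y: "y \<in> V"
  obtains v where "{y, v} \<in> B" "\<not> is_leaf v"
proof (rule ccontr)
  assume n: "\<not> thesis"
  have "V \<subseteq> insert y {v. {y, v} \<in> B}"
  proof (rule connected_closed[of y])
    fix u v assume "u \<in> insert y {v. {y, v} \<in> B}" "{u, v} \<in> B"
    then show "v \<in> insert y {v. {y, v} \<in> B}"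
      using n that leaf_unique[of u v y] by (auto simp: insert_commute)
  qed (use y in auto)
  then show False using star_if_adjacent[OF y] assms(1) by blast
qed

text \<open>If an end of \<open>ab\<close> is a leaf, \<open>leaf_same_side\<close> applies at that
  root; otherwise the whole of \<open>V\<close> lies on one side of \<open>ab\<close>. This yields
  both non-crossing and the line condition of a comb.\<close>

lemma disjoint_edges_same_side:
  assumes ab: "{a, b} \<in> B" and zw: "{z, w} \<in> B" and dis: "{a, b} \<inter> {z, w} = {}"
  shows "orient a b z * orient a b w > 0"
proof -
  have leaf: "orient a b z * orient a b w > 0"
    if lb: "is_leaf a" "{a, b} \<in> B" "{a, b} \<inter> {z, w} = {}" for a b
  proof -
    obtain x where "leaf_blocker V B a x" using is_leafD lb(1) by blast
    then interpret leaf_blocker V B a x .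
    have "x = b" using leaf lb(2) by simp
    then show ?thesis using leaf_same_side[OF zw] lb(3) by auto
  qed
  have sw: "orient b a p = - orient a b p" for p by (simp add: orient_def algebra_simps)
  consider "is_leaf a" | "is_leaf b" | "\<not> is_leaf a" "\<not> is_leaf b" by blast
  then show ?thesis
  proof cases
    case 1 then show ?thesis using leaf ab dis by blast
  next
    case 2
    then have "orient b a z * orient b a w > 0" using leaf[of b a] ab dis by (simp add: insert_commute)
    then show ?thesis by (simp add: sw)
  next
    case 3
    then obtain s where "\<forall>t\<in>V - {a, b}. s * orient a b t > 0"
      using inner_edge_one_side ab unfolding one_side_def by blast
    then have "s * orient a b z > 0" "s * orient a b w > 0" using B_edge[OF zw] dis by auto
    then show ?thesis by (auto simp: zero_less_mult_iff)
  qed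
qed

section \<open>Hull edges at a vertex\<close>

definition hull_edge :: "point \<Rightarrow> point \<Rightarrow> bool" where
  "hull_edge a b \<longleftrightarrow> {a, b} \<in> B \<and> one_side a b"

lemma hull_edge_sym: "hull_edge a b \<Longrightarrow> hull_edge b a"
  using one_side_sym unfolding hull_edge_def by (simp add: insert_commute)

text \<open>Each edge has the other two ends on one side; by antisymmetry of \<open>orient y\<close>
  the three sign conditions are contradictory.\<close>

lemma hull_degree:
  assumes "hull_edge y a" "hull_edge y b" "hull_edge y d" "a \<noteq> b" "a \<noteq> d" "b \<noteq> d"
  shows False
proof -
  obtain s1 s2 s3 where s: "\<forall>t\<in>V - {y, a}. s1 * orient y a t > 0"
      "\<forall>t\<in>V - {y, b}. s2 * orient y b t > 0" "\<forall>t\<in>V - {y, d}. s3 * orient y d t > 0"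
    using assms(1-3) unfolding hull_edge_def one_side_def by blast
  have V: "a \<in> V" "b \<in> V" "d \<in> V" "y \<noteq> a" "y \<noteq> b" "y \<noteq> d"
    using assms(1-3) B_edge unfolding hull_edge_def by blast+
  have "s1 * orient y a b > 0" "s1 * orient y a d > 0" "s2 * orient y b a > 0" "s2 * orient y b d > 0"
       "s3 * orient y d a > 0" "s3 * orient y d b > 0"
    using s V assms(4-6) by auto
  then show False
    unfolding orient_swap[of y b a] orient_swap[of y d a] orient_swap[of y d b]
    by (auto simp: zero_less_mult_iff mult_less_0_iff)
qed

text \<open>One hull edge leads to a neighbour that is not a leaf. If there is only one such
  neighbour, the second hull edge leads to the angularly last of the leaves at
  \<open>y\<close>.\<close>

lemma inner_two_hull_edges:
  assumes ns: "\<not> is_star V B" and y: "y \<in> V" "\<not> is_leaf y"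
  obtains a b where "a \<noteq> b" "hull_edge y a" "hull_edge y b"
proof -
  obtain v where v: "{y, v} \<in> B" "\<not> is_leaf v" using inner_neighbour[OF ns y(1)] .
  have hv: "hull_edge y v" using inner_edge_one_side v y unfolding hull_edge_def by blast
  show ?thesis
  proof (cases "\<exists>w. w \<noteq> v \<and> {y, w} \<in> B \<and> \<not> is_leaf w")
    case True
    then show ?thesis using that hv inner_edge_one_side y unfolding hull_edge_def by metis
  next
    case False
    then have lf: "is_leaf w" if "w \<noteq> v" "{y, w} \<in> B" for w using that by blast
    obtain s where s: "\<forall>t\<in>V - {y, v}. s * orient y v t > 0"
      using hv unfolding hull_edge_def one_side_def by blast
    define L where "L = {w. {y, w} \<in> B \<and> w \<noteq> v}"
    have LV: "L \<subseteq> V - {y, v}" unfolding L_def using B_edge by blast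
    have vV: "v \<in> V" "v \<noteq> y" using B_edge v by blast+
    obtain a b where "{y, a} \<in> B" "{y, b} \<in> B" "a \<noteq> b" using not_leaf_two[OF y] .
    then have Lne: "L \<noteq> {}" unfolding L_def by auto
    have finL: "finite L" using LV finite_V finite_subset by blast
    \<comment> \<open>Counts the leaves preceding \<open>c\<close> in the angular order about
      \<open>y\<close> away from \<open>v\<close>; a maximiser is the last leaf.\<close>
    define r where "r c = card {w \<in> L. s * orient y w c > 0}" for c
    obtain c where c: "c \<in> L" "\<forall>w\<in>L. r w \<le> r c" using finite_ex_max_nat[OF finL Lne] by blast
    have s0: "s \<noteq> 0" using s c(1) LV by auto
    have ext: "s * orient y w c > 0" if w: "w \<in> L" "w \<noteq> c" for w
    proof (rule ccontr)
      assume "\<not> ?thesis"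
      moreover have "orient y w c \<noteq> 0" using orient_nonzero y w c(1) LV by auto
      ultimately have cw: "s * orient y c w > 0"
        using s0 orient_swap[of y c w] by (auto simp: not_less less_le)
      have "{k \<in> L. s * orient y k c > 0} \<subset> {k \<in> L. s * orient y k w > 0}"
      proof
        show "{k \<in> L. s * orient y k c > 0} \<subseteq> {k \<in> L. s * orient y k w > 0}"
          using orient_trans[of s y v _ c w] s LV cw c(1) w(1) by blast
        have "c \<in> {k \<in> L. s * orient y k w > 0}" "c \<notin> {k \<in> L. s * orient y k c > 0}"
          using c(1) cw by simp_all
        then show "{k \<in> L. s * orient y k c > 0} \<noteq> {k \<in> L. s * orient y k w > 0}" by blast
      qed
      then have "r c < r w" unfolding r_def by (rule psubset_card_mono[rotated]) (simp add: finL)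
      then show False using c(2) w(1) by (meson leD)
    qed
    have lc: "is_leaf c" and yc: "{y, c} \<in> B" using c(1) lf unfolding L_def by auto
    obtain x where "leaf_blocker V B c x" using is_leafD[OF lc] .
    then interpret leaf_blocker V B c x .
    have xy: "x = y" using yc leaf' by simp
    have nbr: "s * orient y c t < 0" if t: "{y, t} \<in> B" "t \<noteq> c" for t
    proof (cases "t = v")
      case True
      then show ?thesis using s c(1) LV orient_swap[of y c v] by auto
    next
      case False
      then have "t \<in> L" using t by (simp add: L_def)
      then show ?thesis using ext[of t] t orient_swap[of y c t] by auto
    qed
    \<comment> \<open>The other neighbours of \<open>y\<close> lie on the correct side, and no edge
      avoiding \<open>c\<close> and \<open>y\<close> changes side, so the claim spreads from parent
      to child.\<close>
    have "t \<notin> {c, y} \<longrightarrow> s * orient y c t < 0" if "t \<in> V" for t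
      using that
    proof (induction rule: par_induct)
      case root then show ?case by simp
    next
      case (step t)
      show ?case
      proof
        assume t: "t \<notin> {c, y}"
        have pe: "{t, par t} \<in> B" using par_edge step.hyps by blast
        show "s * orient y c t < 0"
        proof (cases "par t = y")
          case True
          then have "{y, t} \<in> B" using pe by (metis insert_commute)
          then show ?thesis using nbr[of t] t by blast
        next
          case False
          have pc: "par t \<noteq> c"
          proof
            assume "par t = c"
            then have "{t, c} \<in> B" using pe by simp
            then have "t = x" using leaf' by blast
            then show False using t xy by blast
          qed
          then have "s * orient y c (par t) < 0" using step False by simp
          moreover have "orient c y t * orient c y (par t) > 0"
            using leaf_same_side[OF pe] t False pc xy by auto
          moreover have "orient c y p = - orient y c p" for p by (simp add: orient_def algebra_simps)
          ultimately show ?thesis by (auto simp: zero_less_mult_iff mult_less_0_iff)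
        qed
      qed
    qed
    then have "\<forall>t\<in>V - {y, c}. (- s) * orient y c t > 0" by auto
    then have "hull_edge y c" using yc unfolding hull_edge_def one_side_def by blast
    moreover have "v \<noteq> c" using c(1) L_def by auto
    ultimately show ?thesis using that hv by blast
  qed
qed

section \<open>Maximal hull paths and the comb\<close>

definition hull_path :: "point list \<Rightarrow> bool" where
  "hull_path xs \<longleftrightarrow> xs \<noteq> [] \<and> distinct xs \<and> set xs \<subseteq> V
     \<and> (\<forall>i. Suc i < length xs \<longrightarrow> hull_edge (xs ! i) (xs ! Suc i))"

lemma hull_path_rev:
  assumes "hull_path xs" shows "hull_path (rev xs)"
proof -
  have "hull_edge (rev xs ! i) (rev xs ! Suc i)" if i: "Suc i < length xs" for i
  proof -
    define j where "j = length xs - Suc (Suc i)"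
    have "rev xs ! i = xs ! Suc j" "rev xs ! Suc i = xs ! j" "Suc j < length xs"
      using i by (simp_all add: rev_nth j_def Suc_diff_Suc)
    then show ?thesis using assms hull_edge_sym unfolding hull_path_def by simp
  qed
  then show ?thesis using assms unfolding hull_path_def by simp
qed

lemma hull_path_interior:
  assumes xs: "hull_path xs" and i: "0 < i" "Suc i < length xs"
  shows "\<not> is_leaf (xs ! i)"
    and "hull_edge (xs ! i) w \<Longrightarrow> w = xs ! (i - 1) \<or> w = xs ! Suc i"
proof -
  have e: "hull_edge (xs ! i) (xs ! (i - 1))" "hull_edge (xs ! i) (xs ! Suc i)"
  proof -
    have E: "\<And>j. Suc j < length xs \<Longrightarrow> hull_edge (xs ! j) (xs ! Suc j)" using xs by (simp add: hull_path_def)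
    show "hull_edge (xs ! i) (xs ! (i - 1))" using E[of "i - 1"] i hull_edge_sym by simp
    show "hull_edge (xs ! i) (xs ! Suc i)" using E i by simp
  qed
  have ne: "xs ! (i - 1) \<noteq> xs ! Suc i"
    using xs i unfolding hull_path_def by (simp add: nth_eq_iff_index_eq)
  show "\<not> is_leaf (xs ! i)" using leaf_unique e ne unfolding hull_edge_def by blast
  show "hull_edge (xs ! i) w \<Longrightarrow> w = xs ! (i - 1) \<or> w = xs ! Suc i"
    using hull_degree e ne by metis
qed

text \<open>An end that is not a leaf has a second hull edge. It cannot extend the path, so it
  returns to it, which acyclicity and \<open>hull_degree\<close> forbid.\<close>

lemma maximal_hull_path_last:
  assumes ns: "\<not> is_star V B" and xs: "hull_path xs"
    and mx: "\<And>ys. hull_path ys \<Longrightarrow> length ys \<le> length xs"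
  shows "is_leaf (last xs)"
proof (rule ccontr)
  assume nl: "\<not> is_leaf (last xs)"
  define n where "n = length xs"
  have n0: "n > 0" using xs by (simp add: n_def hull_path_def)
  have lx: "last xs = xs ! (n - 1)" using xs by (simp add: n_def last_conv_nth hull_path_def)
  have E: "hull_edge (xs ! i) (xs ! Suc i)" if "Suc i < n" for i using xs that by (simp add: hull_path_def n_def)
  have dist: "xs ! i = xs ! j \<longleftrightarrow> i = j" if "i < n" "j < n" for i j
    using xs that by (simp add: hull_path_def n_def nth_eq_iff_index_eq)
  have lV: "last xs \<in> V" using xs unfolding hull_path_def by auto
  obtain a b where ab: "a \<noteq> b" "hull_edge (last xs) a" "hull_edge (last xs) b"
    using inner_two_hull_edges[OF ns lV nl] .
  \<comment> \<open>A hull neighbour other than the predecessor; the guard covers paths with a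
    single vertex, which have none.\<close>
  obtain w where w: "hull_edge (last xs) w" "n \<ge> 2 \<Longrightarrow> w \<noteq> xs ! (n - 2)" using ab by metis
  have wV: "w \<in> V" "w \<noteq> last xs" using w(1) B_edge unfolding hull_edge_def by blast+
  have "w \<in> set xs"
  proof (rule ccontr)
    assume wx: "w \<notin> set xs"
    have "hull_edge ((xs @ [w]) ! i) ((xs @ [w]) ! Suc i)" if "Suc i < length (xs @ [w])" for i
    proof (cases "Suc i < n")
      case True then show ?thesis using E[of i] by (simp add: nth_append n_def)
    next
      case False
      then have "i = n - 1" "Suc i = n" using that n0 by (auto simp: n_def)
      then show ?thesis using w(1) lx n0 by (auto simp: nth_append n_def)
    qed
    then have "hull_path (xs @ [w])" using xs wx wV unfolding hull_path_def by auto
    then show False using mx[of "xs @ [w]"] by simp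
  qed
  then obtain j where j: "j < n" "w = xs ! j" by (auto simp: in_set_conv_nth n_def)
  have "j \<noteq> n - 1" using j wV lx by auto
  moreover from this have "n \<ge> 2" using j by linarith
  moreover from this have "j \<noteq> n - 2" using j w(2) by auto
  ultimately have jn: "Suc (Suc j) < n" using j by linarith
  show False
  \<comment> \<open>A return to the first vertex closes a cycle of at least three vertices; a return
    to an interior vertex gives that vertex a third hull edge.\<close>
  proof (cases "j = 0")
    case True
    have "is_walk B xs" using xs E unfolding is_walk_def hull_path_def hull_edge_def n_def by simp
    moreover have "{last xs, hd xs} \<in> B"
      using w(1) j True xs by (simp add: hull_edge_def hull_path_def hd_conv_nth)
    ultimately have "has_cycle B" using xs jn
      unfolding has_cycle_def hull_path_def n_def by (intro exI[of _ xs]) auto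
    then show False using B_acyclic by blast
  next
    case False
    have "last xs = xs ! (j - 1) \<or> last xs = xs ! Suc j"
      using hull_path_interior(2)[OF xs, of j "last xs"] hull_edge_sym[OF w(1)] j False jn
      by (simp add: n_def)
    then show False using dist[of "n - 1" "j - 1"] dist[of "n - 1" "Suc j"] lx jn by auto
  qed
qed

text \<open>Every hull edge of \<open>B\<close> has an end that is not a leaf, and both hull edges
  of such a vertex belong to the spine. All vertices off the spine are leaves hanging from its
  interior.\<close>

lemma comb_if_not_star:
  assumes ns: "\<not> is_star V B"
  shows "is_comb V B"
proof -
  obtain y0 where "y0 \<in> V" using V_nonempty by blast
  then obtain y where y: "{y0, y} \<in> B" "\<not> is_leaf y" using inner_neighbour[OF ns] by blast
  then have yV: "y \<in> V" using B_edge by blast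
  obtain a where a: "hull_edge y a" using inner_two_hull_edges[OF ns yV y(2)] .
  have aV: "a \<in> V" "y \<noteq> a" using a B_edge unfolding hull_edge_def by blast+
  have p2: "hull_path [y, a]" using a yV aV by (simp add: hull_path_def)
  have bound: "length ys < Suc (card V)" if "hull_path ys" for ys
    using that distinct_card[of ys] card_mono[OF finite_V, of "set ys"] unfolding hull_path_def by simp
  \<comment> \<open>The spine is a longest hull path; both of its ends are leaves by
    maximality.\<close>
  obtain xs where xs: "hull_path xs" and mx: "\<And>ys. hull_path ys \<Longrightarrow> length ys \<le> length xs"
    using ex_has_greatest_nat[of hull_path "[y, a]" length "Suc (card V)"] p2 bound by blast
  define n where "n = length xs"
  have n2: "n \<ge> 2" using mx[OF p2] by (simp add: n_def)
  have nem: "xs \<noteq> []" using xs by (simp add: hull_path_def)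
  have lx: "last xs = xs ! (n - 1)" and hx: "hd xs = xs ! 0"
    using nem by (simp_all add: n_def last_conv_nth hd_conv_nth)
  have E: "hull_edge (xs ! i) (xs ! Suc i)" if "Suc i < n" for i using xs that by (simp add: hull_path_def n_def)
  have ll: "is_leaf (xs ! (n - 1))" using maximal_hull_path_last[OF ns xs mx] lx by simp
  have "is_leaf (last (rev xs))"
    by (rule maximal_hull_path_last[OF ns hull_path_rev[OF xs]]) (use mx in simp)
  then have lf: "is_leaf (xs ! 0)" using hx nem by (simp add: last_rev)
  have inner: "\<exists>i. 0 < i \<and> Suc i < n \<and> u = xs ! i" if u: "u \<in> set xs" "\<not> is_leaf u" for u
  proof -
    obtain i where i: "i < n" "u = xs ! i" using u(1) by (auto simp: in_set_conv_nth n_def)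
    then have "i \<noteq> 0" "i \<noteq> n - 1" using u(2) lf ll by metis+
    then show ?thesis using i by (intro exI[of _ i]) auto
  qed
  \<comment> \<open>The spine with the leaves on its interior vertices. Closure under adjacency will
    show that this is all of \<open>V\<close>.\<close>
  define K where "K = set xs \<union> {v. is_leaf v \<and> (\<exists>u\<in>path_interior xs. {u, v} \<in> B)}"
  have int_sub: "path_interior xs \<subseteq> set xs" unfolding path_interior_def by auto
  have nbr_path: "v \<in> set xs" if uv: "u \<in> set xs" "is_leaf u" "{u, v} \<in> B" for u v
  proof -
    obtain i where i: "i < n" "u = xs ! i" using uv(1) by (auto simp: in_set_conv_nth n_def)
    show ?thesis
    proof (cases "Suc i < n")
      case True
      then have "v = xs ! Suc i" using E[of i] leaf_unique[OF uv(2)] uv(3) i unfolding hull_edge_def by blast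
      then show ?thesis using True by (simp add: n_def)
    next
      case False
      then obtain j where j: "i = Suc j" using n2 i by (cases i) auto
      then have "v = xs ! j" using hull_edge_sym[OF E[of j]] leaf_unique[OF uv(2)] uv(3) i
        unfolding hull_edge_def by blast
      then show ?thesis using i j by (simp add: n_def)
    qed
  qed
  have VK: "V \<subseteq> K"
  proof (rule connected_closed[of "xs ! 0"])
    show "xs ! 0 \<in> K" using nem by (simp add: K_def)
    show "xs ! 0 \<in> V" using lf by (simp add: is_leaf_def)
    fix u v assume u: "u \<in> K" and uv: "{u, v} \<in> B"
    consider "u \<in> set xs" "is_leaf u" | "u \<in> set xs" "\<not> is_leaf u" | "u \<notin> set xs" by blast
    then show "v \<in> K"
    proof cases
      case 1 then show ?thesis using nbr_path uv by (simp add: K_def)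
    next
      case 2
      then obtain i where i: "0 < i" "Suc i < n" "u = xs ! i" using inner by blast
      show ?thesis
      proof (cases "is_leaf v")
        case True
        moreover have "u \<in> path_interior xs" using i unfolding path_interior_def n_def by blast
        ultimately show ?thesis using uv unfolding K_def by blast
      next
        case False
        then have "hull_edge u v" using inner_edge_one_side 2 uv unfolding hull_edge_def by blast
        then have "v = xs ! (i - 1) \<or> v = xs ! Suc i"
          using hull_path_interior(2)[OF xs, of i v] i by (simp add: n_def)
        then show ?thesis using i by (auto simp: K_def n_def)
      qed
    next
      case 3
      then obtain u' where "is_leaf u" "u' \<in> path_interior xs" "{u', u} \<in> B" using u by (auto simp: K_def)
      then have "v \<in> path_interior xs" using leaf_unique[of u v u'] uv by (auto simp: insert_commute)
      then show ?thesis using int_sub by (auto simp: K_def)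
    qed
  qed
  have Bsub: "B \<subseteq> complete_edges V" using blocker unfolding is_blocker_def by blast
  have fr: "convex hull {a, b} \<subseteq> frontier (convex hull V) \<longleftrightarrow> one_side a b" if "{a, b} \<in> B" for a b
    using one_side_frontier_iff[OF finite_V gp] B_edge[OF that] unfolding one_side_def by blast
  have pe: "{e \<in> B. convex hull e \<subseteq> frontier (convex hull V)} = path_edges xs"
  proof
    show "path_edges xs \<subseteq> {e \<in> B. convex hull e \<subseteq> frontier (convex hull V)}"
      using E fr unfolding path_edges_def hull_edge_def n_def by blast
    have key: "{a, b} \<in> path_edges xs" if ab: "hull_edge a b" "\<not> is_leaf a" for a b
    proof -
      have "a \<in> V" using ab B_edge unfolding hull_edge_def by blast
      then have "a \<in> set xs" using VK ab(2) by (auto simp: K_def)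
      then obtain i where i: "0 < i" "Suc i < n" "a = xs ! i" using inner ab(2) by blast
      then have "b = xs ! (i - 1) \<or> b = xs ! Suc i"
        using hull_path_interior(2)[OF xs, of i b] ab by (simp add: n_def)
      then show ?thesis
      proof
        assume "b = xs ! (i - 1)"
        then have "{a, b} = {xs ! (i - 1), xs ! Suc (i - 1)}" "Suc (i - 1) < length xs"
          using i by (auto simp: n_def)
        then show ?thesis unfolding path_edges_def by blast
      next
        assume "b = xs ! Suc i"
        then show ?thesis using i unfolding path_edges_def n_def by blast
      qed
    qed
    show "{e \<in> B. convex hull e \<subseteq> frontier (convex hull V)} \<subseteq> path_edges xs"
    proof
      fix e assume e: "e \<in> {e \<in> B. convex hull e \<subseteq> frontier (convex hull V)}"
      then obtain a b where ab: "e = {a, b}" "a \<in> V" "b \<in> V" using B_cases by blast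
      then have "{a, b} \<in> B" "convex hull {a, b} \<subseteq> frontier (convex hull V)" using e by blast+
      then have h: "hull_edge a b" using fr unfolding hull_edge_def by blast
      obtain v where v: "{a, v} \<in> B" "\<not> is_leaf v" using inner_neighbour[OF ns ab(2)] .
      \<comment> \<open>If \<open>a\<close> is a leaf, its only neighbour is \<open>v\<close>, so
        \<open>b\<close> is \<open>v\<close> and not a leaf.\<close>
      have "\<not> is_leaf a \<or> \<not> is_leaf b" using leaf_unique v h unfolding hull_edge_def by blast
      then show "e \<in> path_edges xs"
        using key[OF h] key[OF hull_edge_sym[OF h]] ab(1) by (auto simp: insert_commute)
    qed
  qed
  have uniq: "\<forall>v\<in>V - set xs. \<exists>!e. e \<in> B \<and> (\<exists>u\<in>path_interior xs. e = {v, u})"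
  proof
    fix v assume "v \<in> V - set xs"
    then obtain u where u: "is_leaf v" "u \<in> path_interior xs" "{v, u} \<in> B"
      using VK by (auto simp: K_def insert_commute)
    then show "\<exists>!e. e \<in> B \<and> (\<exists>u\<in>path_interior xs. e = {v, u})"
      using leaf_unique[OF u(1)] by (intro ex1I[of _ "{v, u}"]) auto
  qed
  have nc: "noncrossing B"
    unfolding noncrossing_def
  proof (intro ballI)
    fix e f assume ef: "e \<in> B" "f \<in> B"
    obtain a b where ab: "e = {a, b}" "a \<in> V" "b \<in> V" "a \<noteq> b" using B_cases[OF ef(1)] .
    obtain z w where zw: "f = {z, w}" "z \<in> V" "w \<in> V" "z \<noteq> w" using B_cases[OF ef(2)] .
    have sh: "\<not> edges_cross {p, q} {p, r}" if "p \<in> V" "q \<in> V" "r \<in> V" "p \<noteq> q" "p \<noteq> r" for p q r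
      using shared_not_cross orient_nonzero that by metis
    show "\<not> edges_cross e f"
    proof (cases "{a, b} \<inter> {z, w} = {}")
      case True
      then have "orient a b z * orient a b w > 0" using disjoint_edges_same_side ef ab zw by simp
      then have "sgn (orient a b z) * orient a b z > 0 \<and> sgn (orient a b z) * orient a b w > 0"
        by (auto simp: zero_less_mult_iff)
      then show ?thesis using separated_strict[of "sgn (orient a b z)" a b a b z w] ab zw by simp
    next
      case False
      then consider "a = z" | "a = w" | "b = z" | "b = w" by blast
      then show ?thesis
      proof cases
        case 1 then show ?thesis using sh[of a b w] ab zw by simp
      next
        case 2 then show ?thesis using sh[of a b z] ab zw by (simp add: insert_commute)
      next
        case 3 then show ?thesis using sh[of b a w] ab zw by (simp add: insert_commute)
      next
        case 4 then show ?thesis using sh[of b a z] ab zw by (simp add: insert_commute)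
      qed
    qed
  qed
  have lc: "\<forall>e\<in>B. \<forall>f\<in>B. \<not> line_crosses e f"
  proof (intro ballI notI)
    fix e f assume ef: "e \<in> B" "f \<in> B" and cr: "line_crosses e f"
    obtain a b where ab: "e = {a, b}" using B_cases[OF ef(1)] .
    obtain z w where zw: "f = {z, w}" using B_cases[OF ef(2)] .
    have "{a, b} \<inter> {z, w} = {}"
      using cr hull_subset[of e affine] ab zw unfolding line_crosses_def by blast
    then have "orient a b z * orient a b w > 0" using disjoint_edges_same_side ef ab zw by simp
    then have s: "sgn (orient a b z) * orient a b z > 0" "sgn (orient a b z) * orient a b w > 0"
      by (auto simp: zero_less_mult_iff)
    obtain P where P: "P \<in> affine hull {a, b}" "P \<in> convex hull {z, w}"
      using cr ab zw unfolding line_crosses_def by blast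
    obtain k l where kl: "k + l = 1" "P = k *\<^sub>R a + l *\<^sub>R b" using P(1) unfolding affine_hull_2 by blast
    have "orient a b P = 0" using orient_affine[OF kl(1), of a b a b] kl(2) by simp
    then show False using orient_hull_gt[OF P(2) s] by simp
  qed
  show ?thesis
    unfolding is_comb_def using Bsub nc pe uniq lc xs unfolding hull_path_def by blast
qed

end

theorem theorem2:
  fixes V :: "(real^2) set" and B :: "(real^2) set set"
  assumes "finite V"
    and "general_position V"
    and "is_blocker V (trees_le V 4) B"
  shows "is_star V B \<or> is_comb V B"
proof -
  interpret blocker V B using assms by unfold_locales
  show ?thesis using comb_if_not_star by blast
qed

end
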